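(* For every $n\in\mathbb{N}$, the smallest $k\in\mathbb{N}$ such that \[\sup\Big\{\frac{\|z\|_{\pi,n}}{\|z\|_{ah,k}}\colon z\in\mathcal{S}\otimes\mathcal{S},\ z\neq0\Big\}<\infty\] equals $2n+1$.
   Context: Let $\mathbb{N}=\{1,2,\dots\}$. Let $s$ be the space of complex sequences $\xi=(\xi_j)_{j\geqslant1}$ with $|\xi|_n:=(\sum_{j}|\xi_j|^2j^{2n})^{1/2}<\infty$ for all $n\in\mathbb{N}$, and let $s'$ be its dual, the space of sequences $\eta$ with $|\eta|_n':=(\sum_j|\eta_j|^2j^{-2n})^{1/2}<\infty$ for some $n$, with pairing $\langle\xi,\eta\rangle=\sum_j\xi_j\overline{\eta_j}$. The noncommutative Schwartz space $\mathcal{S}=L(s',s)$ is the space of continuous linear operators $s'\to s$ with the topology of uniform convergence on bounded sets; it is a $*$-algebra with product $xy:=x\circ\iota\circ y$ ($\iota\colon s\hookrightarrow s'$ the inclusion) and involution given by $\langle x^*\xi,\eta\rangle=\langle\xi,x\eta\rangle$. For $n\in\mathbb{N}$ and $x\in\mathcal{S}$, $\|x\|_n:=\sup\{|x\xi|_n\colon \xi\in s',\ |\xi|_n'\leqslant1\}$. On the algebraic tensor product $\mathcal{S}\otimes\mathcal{S}$: $\|z\|_{\pi,n}:=\inf\sum_j\|x_j\|_n\|y_j\|_n$ and $\|z\|_{ah,n}:=\inf\|\sum_j|x_j|^2\|_n^{1/2}\|\sum_j|y_j|^2\|_n^{1/2}$, where $|x|^2:=\frac12(x^*x+xx^* )$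 and both infima run over all representations $z=\sum_{j=1}^mx_j\otimes y_j$. *)

theory Defs
  imports Complex_Main
begin

text \<open>Sequences are indexed from 0: the Isabelle entry xi j is the paper's xi_(j+1),
  so the weight j^(2n) of the paper becomes (j+1)^(2n).\<close>

type_synonym cseq = "nat \<Rightarrow> complex"
type_synonym op = "cseq \<Rightarrow> cseq"

definition s_space :: "cseq set" where
  "s_space = {\<xi>. \<forall>n::nat. n \<ge> 1 \<longrightarrow>
       summable (\<lambda>j. (cmod (\<xi> j))\<^sup>2 * (real (Suc j)) ^ (2*n))}"

definition s_dual :: "cseq set" where
  "s_dual = {\<eta>. \<exists>n::nat. n \<ge> 1 \<and>
       summable (\<lambda>j. (cmod (\<eta> j))\<^sup>2 / (real (Suc j)) ^ (2*n))}"

definition snorm :: "nat \<Rightarrow> cseq \<Rightarrow> real" where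
  "snorm n \<xi> = sqrt (\<Sum>j. (cmod (\<xi> j))\<^sup>2 * (real (Suc j)) ^ (2*n))"

definition dual_finite :: "nat \<Rightarrow> cseq \<Rightarrow> bool" where
  "dual_finite n \<eta> \<longleftrightarrow> summable (\<lambda>j. (cmod (\<eta> j))\<^sup>2 / (real (Suc j)) ^ (2*n))"

definition dnorm :: "nat \<Rightarrow> cseq \<Rightarrow> real" where
  "dnorm n \<eta> = sqrt (\<Sum>j. (cmod (\<eta> j))\<^sup>2 / (real (Suc j)) ^ (2*n))"

definition pairing :: "cseq \<Rightarrow> cseq \<Rightarrow> complex" where
  "pairing \<xi> \<eta> = (\<Sum>j. \<xi> j * cnj (\<eta> j))"

definition s_bounded :: "cseq set \<Rightarrow> bool" where
  "s_bounded B \<longleftrightarrow> B \<subseteq> s_space \<and> (\<forall>n::nat. n \<ge> 1 \<longrightarrow> bdd_above (snorm n ` B))"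

text \<open>Continuity of a linear map s' \<rightarrow> s, where s' carries the strong dual topology
  (seminorms  eta \<mapsto> sup over xi in B of |<xi,eta>|, B bounded in s) and s its Frechet topology.\<close>
definition continuous_op :: "op \<Rightarrow> bool" where
  "continuous_op x \<longleftrightarrow> (\<forall>n::nat. n \<ge> 1 \<longrightarrow> (\<exists>B C. s_bounded B \<and>
      (\<forall>\<eta>\<in>s_dual. snorm n (x \<eta>) \<le> C * Sup ((\<lambda>\<xi>. cmod (pairing \<xi> \<eta>)) ` B))))"

text \<open>The noncommutative Schwartz space L(s',s). Operators are represented as functions on
  all sequences that vanish outside s' (canonical representatives).\<close>
definition NCS :: "op set" where
  "NCS = {x. (\<forall>\<eta>\<in>s_dual. \<forall>\<eta>'\<in>s_dual. x (\<lambda>j. \<eta> j + \<eta>' j) = (\<lambda>j. x \<eta> j + x \<eta>' j))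
           \<and> (\<forall>\<eta>\<in>s_dual. \<forall>c. x (\<lambda>j. c * \<eta> j) = (\<lambda>j. c * x \<eta> j))
           \<and> (\<forall>\<eta>\<in>s_dual. x \<eta> \<in> s_space)
           \<and> (\<forall>\<eta>. \<eta> \<notin> s_dual \<longrightarrow> x \<eta> = (\<lambda>_. 0))
           \<and> continuous_op x}"

definition op_mult :: "op \<Rightarrow> op \<Rightarrow> op" where
  "op_mult x y = (\<lambda>\<eta>. x (y \<eta>))"

definition op_adj :: "op \<Rightarrow> op" where
  "op_adj x = (\<lambda>\<xi>. if \<xi> \<in> s_dual then
      (THE v. v \<in> s_space \<and> (\<forall>\<eta>\<in>s_dual. pairing v \<eta> = pairing \<xi> (x \<eta>))) else (\<lambda>_. 0))"

definition op_absq :: "op \<Rightarrow> op" where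
  "op_absq x = (\<lambda>\<eta> i. (op_mult (op_adj x) x \<eta> i + op_mult x (op_adj x) \<eta> i) / 2)"

definition opnorm :: "nat \<Rightarrow> op \<Rightarrow> real" where
  "opnorm n x = Sup {snorm n (x \<xi>) | \<xi>. \<xi> \<in> s_dual \<and> dual_finite n \<xi> \<and> dnorm n \<xi> \<le> 1}"

text \<open>Algebraic tensor product S \<otimes> S, realised (injectively) as functions on pairs of
  coordinate evaluations: x \<otimes> y \<mapsto> ((eta,i),(eta',i')) \<mapsto> (x eta)_i (y eta')_i'.\<close>
type_synonym tens = "cseq \<times> nat \<Rightarrow> cseq \<times> nat \<Rightarrow> complex"

definition tensor_of :: "nat \<Rightarrow> (nat \<Rightarrow> op) \<Rightarrow> (nat \<Rightarrow> op) \<Rightarrow> tens" where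
  "tensor_of m X Y = (\<lambda>(\<eta>, i) (\<eta>', i'). if \<eta> \<in> s_dual \<and> \<eta>' \<in> s_dual
       then (\<Sum>j<m. X j \<eta> i * Y j \<eta>' i') else 0)"

definition NCS_tensor :: "tens set" where
  "NCS_tensor = {tensor_of m X Y | m X Y. \<forall>j<m. X j \<in> NCS \<and> Y j \<in> NCS}"

definition pi_norm :: "nat \<Rightarrow> tens \<Rightarrow> real" where
  "pi_norm n z = Inf {(\<Sum>j<m. opnorm n (X j) * opnorm n (Y j)) | m X Y.
       m \<ge> 1 \<and> (\<forall>j<m. X j \<in> NCS \<and> Y j \<in> NCS) \<and> tensor_of m X Y = z}"

definition sum_absq :: "nat \<Rightarrow> (nat \<Rightarrow> op) \<Rightarrow> op" where
  "sum_absq m X = (\<lambda>\<eta> i. \<Sum>j<m. op_absq (X j) \<eta> i)"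

definition ah_norm :: "nat \<Rightarrow> tens \<Rightarrow> real" where
  "ah_norm n z = Inf {sqrt (opnorm n (sum_absq m X)) * sqrt (opnorm n (sum_absq m Y)) | m X Y.
       m \<ge> 1 \<and> (\<forall>j<m. X j \<in> NCS \<and> Y j \<in> NCS) \<and> tensor_of m X Y = z}"

definition ratio_bounded :: "nat \<Rightarrow> nat \<Rightarrow> bool" where
  "ratio_bounded n k \<longleftrightarrow>
     bdd_above {pi_norm n z / ah_norm k z | z. z \<in> NCS_tensor \<and> z \<noteq> (\<lambda>_ _. 0)}"

end

theory Submission
  imports Defs "HOL-Analysis.Summation_Tests" "HOL-Analysis.Convex"
begin

text \<open>Idea. Regard operators as rapidly decreasing matrices; then \<open>\<parallel>x\<parallel>\<^sub>n\<close> is the operator norm of \<open>(i\<^sup>n x\<^sub>i\<^sub>j j\<^sup>n)\<close>.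

  Upper bound: by Cauchy--Schwarz it suffices to bound the sum of the \<open>\<parallel>x\<^sub>l\<parallel>\<^sub>n\<^sup>2\<close> over a representation. Estimate each
  operator norm by the Hilbert--Schmidt norm and use \<open>(i j)\<^bsup>2n\<^esup> \<le> (i\<^bsup>4n\<^esup> + j\<^bsup>4n\<^esup>) / 2\<close>. What remains is the sum of
  \<open>a\<^bsup>4n\<^esup> R\<^sub>a\<^sub>a\<close> with \<open>R\<close> the sum of the \<open>|x\<^sub>l|\<^sup>2\<close>, and \<open>a\<^bsup>4n+2\<^esup> R\<^sub>a\<^sub>a \<le> \<parallel>R\<parallel>\<close> in the norm of index \<open>2n+1\<close>, so the
  sum converges like the sum of \<open>a\<^bsup>-2\<^esup>\<close>.

  Lower bound: for \<open>k \<le> 2n\<close> take the sum of \<open>e\<^sub>p\<^sub>j \<otimes> e\<^sub>p\<^sub>j\<close> over \<open>j\<close> of size about \<open>Q\<close>, for a fixed row \<open>p\<close>. Its projective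
  norm is that of the identity in the projective square of a \<open>Q\<close>-dimensional Hilbert space, at least
  \<open>Q (p Q)\<^bsup>2n\<^esup>\<close>, while its \<open>ah\<close>-norm is of order at most \<open>max (Q p\<^bsup>4n\<^esup>) (Q\<^bsup>4n\<^esup>)\<close>. Choosing \<open>p\<close> so that the two terms
  agree gives a ratio of order \<open>Q\<^bsup>1/2\<^esup>\<close>.\<close>

section \<open>Weighted square-summable sequences\<close>

abbreviation unit_seq :: "nat \<Rightarrow> cseq" where
  "unit_seq j \<equiv> (\<lambda>i. if i = j then 1 else 0)"

lemma snorm_alt: "snorm n \<xi> = sqrt (\<Sum>j. (cmod (\<xi> j) * real (Suc j) ^ n)\<^sup>2)"
  unfolding snorm_def by (simp only: power_mult_distrib power_mult[symmetric] mult.commute[of n 2])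

lemma dnorm_alt: "dnorm n \<eta> = sqrt (\<Sum>j. (cmod (\<eta> j) / real (Suc j) ^ n)\<^sup>2)"
  unfolding dnorm_def by (simp only: power_divide power_mult[symmetric] mult.commute[of n 2])

lemma dual_finite_alt: "dual_finite n \<eta> \<longleftrightarrow> summable (\<lambda>j. (cmod (\<eta> j) / real (Suc j) ^ n)\<^sup>2)"
  unfolding dual_finite_def by (simp only: power_divide power_mult[symmetric] mult.commute[of n 2])

lemma s_space_alt:
  "\<xi> \<in> s_space \<longleftrightarrow> (\<forall>n\<ge>1. summable (\<lambda>j. (cmod (\<xi> j) * real (Suc j) ^ n)\<^sup>2))"
  unfolding s_space_def
  by (simp only: mem_Collect_eq power_mult_distrib power_mult[symmetric] mult.commute[of _ 2])

lemma s_dual_iff: "\<eta> \<in> s_dual \<longleftrightarrow> (\<exists>n\<ge>1. dual_finite n \<eta>)"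
  by (auto simp: s_dual_def dual_finite_def)

lemma s_dualI: "n \<ge> 1 \<Longrightarrow> dual_finite n \<eta> \<Longrightarrow> \<eta> \<in> s_dual"
  by (auto simp: s_dual_iff)

lemma dnorm_nonneg: "dual_finite n \<eta> \<Longrightarrow> dnorm n \<eta> \<ge> 0"
  by (auto simp: dnorm_alt dual_finite_alt intro!: suminf_nonneg)

lemma dnorm_power2: "dual_finite n \<eta> \<Longrightarrow> (dnorm n \<eta>)\<^sup>2 = (\<Sum>j. (cmod (\<eta> j) / real (Suc j) ^ n)\<^sup>2)"
  by (auto simp: dnorm_alt dual_finite_alt intro!: suminf_nonneg)

lemma snorm_nonneg: "n \<ge> 1 \<Longrightarrow> \<xi> \<in> s_space \<Longrightarrow> snorm n \<xi> \<ge> 0"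
  by (auto simp: snorm_alt s_space_alt intro!: suminf_nonneg)

lemma norm_entry_le_snorm:
  assumes "n \<ge> 1" "\<xi> \<in> s_space"
  shows "cmod (\<xi> i) * real (Suc i) ^ n \<le> snorm n \<xi>"
proof -
  have "(\<Sum>j\<in>{i}. (cmod (\<xi> j) * real (Suc j) ^ n)\<^sup>2) \<le> (\<Sum>j. (cmod (\<xi> j) * real (Suc j) ^ n)\<^sup>2)"
    using assms by (intro sum_le_suminf) (auto simp: s_space_alt)
  then show ?thesis
    unfolding snorm_alt by (intro real_le_rsqrt) simp
qed

section \<open>Cauchy--Schwarz and the pairing between s and s'\<close>

lemma Cauchy_Schwarz_suminf:
  fixes f g :: "nat \<Rightarrow> real"
  assumes f: "summable (\<lambda>j. (f j)\<^sup>2)" and g: "summable (\<lambda>j. (g j)\<^sup>2)"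
  shows "summable (\<lambda>j. \<bar>f j * g j\<bar>)"
    and "(\<Sum>j. \<bar>f j * g j\<bar>) \<le> sqrt (\<Sum>j. (f j)\<^sup>2) * sqrt (\<Sum>j. (g j)\<^sup>2)"
proof -
  have *: "(\<Sum>j<n. \<bar>f j * g j\<bar>) \<le> sqrt (\<Sum>j. (f j)\<^sup>2) * sqrt (\<Sum>j. (g j)\<^sup>2)" for n
  proof -
    have "(\<Sum>j<n. \<bar>f j * g j\<bar>)\<^sup>2 \<le> (\<Sum>j<n. (f j)\<^sup>2) * (\<Sum>j<n. (g j)\<^sup>2)"
      using Cauchy_Schwarz_ineq_sum[of "\<lambda>j. \<bar>f j\<bar>" "\<lambda>j. \<bar>g j\<bar>" "{..<n}"] by (simp add: abs_mult)
    also have "\<dots> \<le> (\<Sum>j. (f j)\<^sup>2) * (\<Sum>j. (g j)\<^sup>2)"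
      by (intro mult_mono sum_le_suminf f g suminf_nonneg sum_nonneg) auto
    finally show ?thesis
      by (simp add: real_le_rsqrt flip: real_sqrt_mult)
  qed
  show 1: "summable (\<lambda>j. \<bar>f j * g j\<bar>)"
    by (rule summableI_nonneg_bounded[OF _ *]) simp
  show "(\<Sum>j. \<bar>f j * g j\<bar>) \<le> sqrt (\<Sum>j. (f j)\<^sup>2) * sqrt (\<Sum>j. (g j)\<^sup>2)"
    by (rule suminf_le_const[OF 1 *])
qed

lemma pairing_bound:
  assumes "n \<ge> 1" "\<xi> \<in> s_space" "dual_finite n \<eta>"
  shows "summable (\<lambda>j. \<xi> j * cnj (\<eta> j))" and "cmod (pairing \<xi> \<eta>) \<le> snorm n \<xi> * dnorm n \<eta>"
proof -
  have eq: "\<bar>cmod (\<xi> j) * real (Suc j) ^ n * (cmod (\<eta> j) / real (Suc j) ^ n)\<bar> = cmod (\<xi> j * cnj (\<eta> j))" for j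
    by (simp add: norm_mult abs_mult)
  note CS = Cauchy_Schwarz_suminf[of "\<lambda>j. cmod (\<xi> j) * real (Suc j) ^ n"
      "\<lambda>j. cmod (\<eta> j) / real (Suc j) ^ n", unfolded eq]
  have s: "summable (\<lambda>j. cmod (\<xi> j * cnj (\<eta> j)))"
    using CS(1) assms by (simp only: s_space_alt dual_finite_alt)
  then show "summable (\<lambda>j. \<xi> j * cnj (\<eta> j))"
    by (rule summable_norm_cancel)
  show "cmod (pairing \<xi> \<eta>) \<le> snorm n \<xi> * dnorm n \<eta>"
    unfolding pairing_def snorm_alt dnorm_alt
    using order_trans[OF summable_norm[OF s] CS(2)] assms by (simp only: s_space_alt dual_finite_alt)
qed

lemma pairing_cnj: "pairing \<eta> \<xi> = cnj (pairing \<xi> \<eta>)"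
  if "n \<ge> 1" "\<xi> \<in> s_space" "dual_finite n \<eta>"
proof -
  have "(\<lambda>j. cnj (\<xi> j * cnj (\<eta> j))) sums cnj (pairing \<xi> \<eta>)"
    unfolding pairing_def sums_cnj by (rule summable_sums[OF pairing_bound(1)[OF that]])
  then show ?thesis
    by (simp add: sums_iff pairing_def[of \<eta>] mult.commute)
qed

text \<open>The value zeta(2), written with indices from 0. It is the constant of the upper bound
  and also the price of passing from entrywise decay to weighted l2 norms.\<close>

definition zeta2 :: real where
  "zeta2 = (\<Sum>j. (1 / real (Suc j))\<^sup>2)"

lemma summable_zeta2: "summable (\<lambda>j. (1 / real (Suc j))\<^sup>2)"
proof -
  have "summable (\<lambda>j. inverse (real (Suc j) ^ 2))"
    using inverse_power_summable[of 2, where 'a = real] summable_Suc_iff[of "\<lambda>j. inverse (real j ^ 2)"]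
    by simp
  then show ?thesis
    by (simp add: power_divide inverse_eq_divide)
qed

lemma zeta2_pos: "zeta2 > 0"
  unfolding zeta2_def by (rule suminf_pos[OF summable_zeta2]) simp

text \<open>One surplus power of the weight leaves squares dominated by
  \<open>K\<^sup>2 / (i+1)\<^sup>2\<close>. Sup-type bounds on entries therefore control the
  Hilbertian norms at the cost of one index.\<close>

lemma snorm_le_of_entries:
  assumes "\<And>i. cmod (\<xi> i) * real (Suc i) ^ Suc n \<le> K"
  shows "summable (\<lambda>j. (cmod (\<xi> j) * real (Suc j) ^ n)\<^sup>2)" and "snorm n \<xi> \<le> K * sqrt zeta2"
proof -
  have K: "K \<ge> 0"
    using assms[of 0] by (auto intro: order_trans[OF norm_ge_zero])
  have le: "(cmod (\<xi> i) * real (Suc i) ^ n)\<^sup>2 \<le> K\<^sup>2 * (1 / real (Suc i))\<^sup>2" for i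
  proof -
    have "cmod (\<xi> i) * real (Suc i) ^ n \<le> K * (1 / real (Suc i))"
      using assms[of i] by (simp add: field_simps)
    then show ?thesis
      unfolding power_mult_distrib[of K, symmetric] by (intro power_mono) auto
  qed
  show s: "summable (\<lambda>j. (cmod (\<xi> j) * real (Suc j) ^ n)\<^sup>2)"
    by (rule summable_comparison_test'[OF summable_mult[OF summable_zeta2, of "K\<^sup>2"]])
      (use le in auto)
  have "(\<Sum>j. (cmod (\<xi> j) * real (Suc j) ^ n)\<^sup>2) \<le> (\<Sum>j. K\<^sup>2 * (1 / real (Suc j))\<^sup>2)"
    by (intro suminf_le le s summable_mult summable_zeta2)
  also have "\<dots> = K\<^sup>2 * zeta2"
    unfolding zeta2_def by (rule suminf_mult[OF summable_zeta2])
  finally have "snorm n \<xi> \<le> sqrt (K\<^sup>2 * zeta2)"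
    unfolding snorm_alt by (rule real_sqrt_le_mono)
  then show "snorm n \<xi> \<le> K * sqrt zeta2"
    using K by (simp add: real_sqrt_mult)
qed

lemma s_space_of_entries:
  assumes "\<And>n. n \<ge> 1 \<Longrightarrow> \<exists>K. \<forall>i. cmod (\<xi> i) * real (Suc i) ^ n \<le> K"
  shows "\<xi> \<in> s_space"
  unfolding s_space_alt
proof (intro allI impI)
  fix n :: nat
  obtain K where "\<forall>i. cmod (\<xi> i) * real (Suc i) ^ Suc n \<le> K"
    using assms[of "Suc n"] by auto
  then show "summable (\<lambda>j. (cmod (\<xi> j) * real (Suc j) ^ n)\<^sup>2)"
    by (intro snorm_le_of_entries(1)) auto
qed

text \<open>All weights are at least 1, so dividing by them gives less than multiplying. This
  quantitative form of the inclusion of s in s' is what composition of operators needs.\<close>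

lemma s_space_dual_finite:
  assumes "\<xi> \<in> s_space" "n \<ge> 1"
  shows "dual_finite n \<xi>" and "dnorm n \<xi> \<le> snorm n \<xi>"
proof -
  have le: "(cmod (\<xi> j) / real (Suc j) ^ n)\<^sup>2 \<le> (cmod (\<xi> j) * real (Suc j) ^ n)\<^sup>2" for j
  proof -
    have "1 \<le> real (Suc j) ^ n" by (rule one_le_power) simp
    then have "cmod (\<xi> j) / real (Suc j) ^ n \<le> cmod (\<xi> j) / 1"
      by (intro divide_left_mono) auto
    also have "\<dots> \<le> cmod (\<xi> j) * real (Suc j) ^ n"
      using \<open>1 \<le> real (Suc j) ^ n\<close> mult_left_mono[of 1 "real (Suc j) ^ n" "cmod (\<xi> j)"] by simp
    finally show ?thesis by (intro power_mono) auto
  qed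
  have s: "summable (\<lambda>j. (cmod (\<xi> j) * real (Suc j) ^ n)\<^sup>2)"
    using assms by (simp add: s_space_alt)
  show "dual_finite n \<xi>"
    unfolding dual_finite_alt by (rule summable_comparison_test'[OF s]) (use le in auto)
  then show "dnorm n \<xi> \<le> snorm n \<xi>"
    unfolding dnorm_alt snorm_alt dual_finite_alt
    by (intro real_sqrt_le_mono suminf_le le s)
qed

lemma s_space_subset_s_dual: "\<xi> \<in> s_space \<Longrightarrow> \<xi> \<in> s_dual"
  using s_space_dual_finite(1)[of \<xi> 1] by (auto simp: s_dual_iff)

lemma unit_seq_dual:
  shows "dual_finite n (unit_seq j)" and "dnorm n (unit_seq j) = 1 / real (Suc j) ^ n"
proof -
  have eq: "(\<lambda>i. (cmod (unit_seq j i) / real (Suc i) ^ n)\<^sup>2)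
      = (\<lambda>i. if i = j then (1 / real (Suc i) ^ n)\<^sup>2 else 0)"
    by auto
  have "(\<lambda>i. (cmod (unit_seq j i) / real (Suc i) ^ n)\<^sup>2) sums (1 / real (Suc j) ^ n)\<^sup>2"
    unfolding eq by (rule sums_single)
  note sums = this
  show "dual_finite n (unit_seq j)"
    unfolding dual_finite_alt by (rule sums_summable[OF sums])
  show "dnorm n (unit_seq j) = 1 / real (Suc j) ^ n"
    unfolding dnorm_alt sums_unique[OF sums, symmetric] real_sqrt_abs by (rule abs_of_nonneg) simp
qed

lemma unit_seq_s_dual [simp]: "unit_seq j \<in> s_dual"
  using s_dualI[of 1, OF _ unit_seq_dual(1)] by simp

lemma real_add_power2_le: "(a + b)\<^sup>2 \<le> 2 * a\<^sup>2 + 2 * b\<^sup>2" for a b :: real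
  using sum_squares_bound[of a b] by (simp add: power2_sum)

lemma dual_finite_add: "dual_finite n \<eta> \<Longrightarrow> dual_finite n \<eta>' \<Longrightarrow> dual_finite n (\<lambda>j. \<eta> j + \<eta>' j)"
  unfolding dual_finite_alt
proof (rule summable_comparison_test'[OF summable_add[OF summable_mult[of _ 2] summable_mult[of _ 2]]])
  fix j :: nat
  have "(cmod (\<eta> j + \<eta>' j) / real (Suc j) ^ n)\<^sup>2 \<le> ((cmod (\<eta> j) + cmod (\<eta>' j)) / real (Suc j) ^ n)\<^sup>2"
    by (intro power_mono divide_right_mono norm_triangle_ineq) auto
  also have "\<dots> \<le> 2 * (cmod (\<eta> j) / real (Suc j) ^ n)\<^sup>2 + 2 * (cmod (\<eta>' j) / real (Suc j) ^ n)\<^sup>2"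
    unfolding add_divide_distrib by (rule real_add_power2_le)
  finally show "norm ((cmod (\<eta> j + \<eta>' j) / real (Suc j) ^ n)\<^sup>2)
      \<le> 2 * (cmod (\<eta> j) / real (Suc j) ^ n)\<^sup>2 + 2 * (cmod (\<eta>' j) / real (Suc j) ^ n)\<^sup>2"
    by simp
qed

lemma dual_finite_cmult:
  assumes "dual_finite n \<eta>"
  shows "dual_finite n (\<lambda>j. c * \<eta> j)" and "dnorm n (\<lambda>j. c * \<eta> j) = cmod c * dnorm n \<eta>"
proof -
  have eq: "(cmod (c * \<eta> j) / real (Suc j) ^ n)\<^sup>2 = (cmod c)\<^sup>2 * (cmod (\<eta> j) / real (Suc j) ^ n)\<^sup>2" for j
    by (simp add: norm_mult power_mult_distrib power_divide)
  have s: "summable (\<lambda>j. (cmod (\<eta> j) / real (Suc j) ^ n)\<^sup>2)"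
    using assms by (simp only: dual_finite_alt)
  show "dual_finite n (\<lambda>j. c * \<eta> j)"
    unfolding dual_finite_alt eq by (rule summable_mult[OF s])
  show "dnorm n (\<lambda>j. c * \<eta> j) = cmod c * dnorm n \<eta>"
    unfolding dnorm_alt eq suminf_mult[OF s] real_sqrt_mult by simp
qed

lemma dual_finite_mono:
  assumes "dual_finite m \<eta>" "m \<le> n"
  shows "dual_finite n \<eta>"
  unfolding dual_finite_alt
proof (rule summable_comparison_test'[OF assms(1)[unfolded dual_finite_alt]])
  fix j :: nat
  have "cmod (\<eta> j) / real (Suc j) ^ n \<le> cmod (\<eta> j) / real (Suc j) ^ m"
    by (intro divide_left_mono power_increasing mult_pos_pos) (use assms in auto)
  then show "norm ((cmod (\<eta> j) / real (Suc j) ^ n)\<^sup>2) \<le> (cmod (\<eta> j) / real (Suc j) ^ m)\<^sup>2"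
    by (auto intro: power_mono)
qed

lemma s_dual_add: "\<eta> \<in> s_dual \<Longrightarrow> \<eta>' \<in> s_dual \<Longrightarrow> (\<lambda>j. \<eta> j + \<eta>' j) \<in> s_dual"
proof -
  assume "\<eta> \<in> s_dual" "\<eta>' \<in> s_dual"
  then obtain n m where "n \<ge> 1" "dual_finite n \<eta>" "dual_finite m \<eta>'"
    by (auto simp: s_dual_iff)
  then show ?thesis
    by (intro s_dualI[of "max n m"] dual_finite_add dual_finite_mono[of n _ "max n m"]
        dual_finite_mono[of m _ "max n m"]) auto
qed

lemma s_dual_cmult: "\<eta> \<in> s_dual \<Longrightarrow> (\<lambda>j. c * \<eta> j) \<in> s_dual"
  unfolding s_dual_iff using dual_finite_cmult(1) by blast

section \<open>Expansion of bounded functionals in unit sequences\<close>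

lemma dnorm_tail_tendsto_0:
  assumes "dual_finite m \<eta>"
  shows "(\<lambda>N. dnorm m (\<lambda>i. if i < N then 0 else \<eta> i)) \<longlonglongrightarrow> 0"
    and "dual_finite m (\<lambda>i. if i < N then 0 else \<eta> i)"
proof -
  define a where "a = (\<lambda>j. (cmod (\<eta> j) / real (Suc j) ^ m)\<^sup>2)"
  have a: "summable a"
    using assms unfolding a_def dual_finite_alt .
  have eq: "(\<lambda>j. (cmod (if j < N then 0 else \<eta> j) / real (Suc j) ^ m)\<^sup>2)
      = (\<lambda>j. a j - (if j \<in> {..<N} then a j else 0))" for N
    by (rule ext) (simp add: a_def)
  have sums: "(\<lambda>j. (cmod (if j < N then 0 else \<eta> j) / real (Suc j) ^ m)\<^sup>2)
      sums (suminf a - (\<Sum>j<N. a j))" for N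
    unfolding eq by (intro sums_diff summable_sums a sums_If_finite_set) simp
  show "dual_finite m (\<lambda>i. if i < N then 0 else \<eta> i)"
    unfolding dual_finite_alt by (rule sums_summable[OF sums])
  have "(\<lambda>N. suminf a - (\<Sum>j<N. a j)) \<longlonglongrightarrow> suminf a - suminf a"
    by (intro tendsto_diff tendsto_const summable_LIMSEQ a)
  then have "(\<lambda>N. sqrt (suminf a - (\<Sum>j<N. a j))) \<longlonglongrightarrow> sqrt 0"
    by (intro tendsto_real_sqrt) simp
  then show "(\<lambda>N. dnorm m (\<lambda>i. if i < N then 0 else \<eta> i)) \<longlonglongrightarrow> 0"
    unfolding dnorm_alt sums_unique[OF sums, symmetric] by simp
qed

text \<open>Additivity splits off one coordinate at a time; the remaining tail has dual norm tending
  to 0, so the bound on \<open>F\<close> kills it. The lemma is applied to the coordinates of an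
  operator and to pairings with a fixed element of s'.\<close>

lemma functional_expansion:
  fixes F :: "cseq \<Rightarrow> complex"
  assumes add: "\<And>\<eta> \<eta>'. \<eta> \<in> s_dual \<Longrightarrow> \<eta>' \<in> s_dual \<Longrightarrow> F (\<lambda>j. \<eta> j + \<eta>' j) = F \<eta> + F \<eta>'"
    and cmult: "\<And>\<eta> c. \<eta> \<in> s_dual \<Longrightarrow> F (\<lambda>j. c * \<eta> j) = c * F \<eta>"
    and bound: "\<And>\<zeta>. dual_finite m \<zeta> \<Longrightarrow> cmod (F \<zeta>) \<le> K * dnorm m \<zeta>"
    and m: "m \<ge> 1" and \<eta>: "dual_finite m \<eta>"
  shows "(\<lambda>j. \<eta> j * F (unit_seq j)) sums F \<eta>"
proof -
  define tail where "tail = (\<lambda>N i. if i < N then 0 else \<eta> i)"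
  have tail: "dual_finite m (tail N)" for N
    unfolding tail_def by (rule dnorm_tail_tendsto_0(2)[OF \<eta>])
  have split: "F \<eta> = (\<Sum>j<N. \<eta> j * F (unit_seq j)) + F (tail N)" for N
  proof (induction N)
    case 0
    then show ?case by (simp add: tail_def)
  next
    case (Suc N)
    have "tail N = (\<lambda>j. (\<eta> N * unit_seq N j) + tail (Suc N) j)"
      by (auto simp: tail_def fun_eq_iff less_Suc_eq)
    then have "F (tail N) = F (\<lambda>j. \<eta> N * unit_seq N j) + F (tail (Suc N))"
      by (simp only: add[OF s_dual_cmult[OF unit_seq_s_dual] s_dualI[OF m tail]])
    then show ?case
      using Suc by (simp add: cmult[OF unit_seq_s_dual])
  qed
  have "(\<lambda>N. K * dnorm m (tail N)) \<longlonglongrightarrow> K * 0"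
    unfolding tail_def by (intro tendsto_mult tendsto_const dnorm_tail_tendsto_0(1) \<eta>)
  then have "(\<lambda>N. F (tail N)) \<longlonglongrightarrow> 0"
    using Lim_null_comparison[OF always_eventually[OF allI[OF bound[OF tail]]]] by simp
  then have "(\<lambda>N. F \<eta> - F (tail N)) \<longlonglongrightarrow> F \<eta> - 0"
    by (intro tendsto_diff tendsto_const)
  moreover have "F \<eta> - F (tail N) = (\<Sum>j<N. \<eta> j * F (unit_seq j))" for N
    using split[of N] by simp
  ultimately show ?thesis
    unfolding sums_def by simp
qed

section \<open>Smoothing operators\<close>

text \<open>The bounds are stated entrywise, so that sums of operators need no Minkowski inequality.\<close>

definition smoothing :: "op \<Rightarrow> bool" where
  "smoothing x \<longleftrightarrow>
     (\<forall>\<eta>\<in>s_dual. \<forall>\<eta>'\<in>s_dual. x (\<lambda>j. \<eta> j + \<eta>' j) = (\<lambda>j. x \<eta> j + x \<eta>' j)) \<and>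
     (\<forall>\<eta>\<in>s_dual. \<forall>c. x (\<lambda>j. c * \<eta> j) = (\<lambda>j. c * x \<eta> j)) \<and>
     (\<forall>n m. n \<ge> 1 \<longrightarrow> m \<ge> 1 \<longrightarrow>
       (\<exists>K. \<forall>\<eta> i. dual_finite m \<eta> \<longrightarrow> cmod (x \<eta> i) * real (Suc i) ^ n \<le> K * dnorm m \<eta>))"

lemma smoothing_add:
  "smoothing x \<Longrightarrow> \<eta> \<in> s_dual \<Longrightarrow> \<eta>' \<in> s_dual \<Longrightarrow> x (\<lambda>j. \<eta> j + \<eta>' j) = (\<lambda>j. x \<eta> j + x \<eta>' j)"
  by (auto simp: smoothing_def)

lemma smoothing_cmult:
  "smoothing x \<Longrightarrow> \<eta> \<in> s_dual \<Longrightarrow> x (\<lambda>j. c * \<eta> j) = (\<lambda>j. c * x \<eta> j)"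
  by (auto simp: smoothing_def)

lemma smoothing_bound:
  assumes "smoothing x" "n \<ge> 1" "m \<ge> 1"
  obtains K where "K \<ge> 0" "\<And>\<eta> i. dual_finite m \<eta> \<Longrightarrow> cmod (x \<eta> i) * real (Suc i) ^ n \<le> K * dnorm m \<eta>"
proof -
  obtain K where K: "\<forall>\<eta> i. dual_finite m \<eta> \<longrightarrow> cmod (x \<eta> i) * real (Suc i) ^ n \<le> K * dnorm m \<eta>"
    using assms unfolding smoothing_def by blast
  have "cmod (x \<eta> i) * real (Suc i) ^ n \<le> \<bar>K\<bar> * dnorm m \<eta>" if "dual_finite m \<eta>" for \<eta> i
    using K that by (intro order_trans[OF _ mult_right_mono[OF abs_ge_self dnorm_nonneg]]) auto
  then show ?thesis
    by (intro that[of "\<bar>K\<bar>"]) auto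
qed

text \<open>The entrywise bound with index \<open>Suc n\<close> is summed by
  \<open>snorm_le_of_entries\<close>, which uses up the extra power.\<close>

lemma smoothing_snorm_bound:
  assumes "smoothing x" "m \<ge> 1"
  obtains K where "K \<ge> 0" "\<And>\<eta>. dual_finite m \<eta> \<Longrightarrow> snorm n (x \<eta>) \<le> K * dnorm m \<eta>"
proof -
  obtain K where K: "K \<ge> 0"
      "\<And>\<eta> i. dual_finite m \<eta> \<Longrightarrow> cmod (x \<eta> i) * real (Suc i) ^ Suc n \<le> K * dnorm m \<eta>"
    using smoothing_bound[OF assms(1), of "Suc n" m] assms(2) by auto
  show ?thesis
  proof (rule that[of "K * sqrt zeta2"])
    show "K * sqrt zeta2 \<ge> 0" using K(1) zeta2_pos by simp
    show "snorm n (x \<eta>) \<le> K * sqrt zeta2 * dnorm m \<eta>" if "dual_finite m \<eta>" for \<eta>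
      using snorm_le_of_entries(2)[OF K(2)[OF that]] by (simp add: mult_ac)
  qed
qed

lemma smoothing_s_space:
  assumes "smoothing x" "\<eta> \<in> s_dual"
  shows "x \<eta> \<in> s_space"
proof (rule s_space_of_entries)
  fix n :: nat assume "n \<ge> 1"
  obtain m where m: "m \<ge> 1" "dual_finite m \<eta>"
    using assms by (auto simp: s_dual_iff)
  then show "\<exists>K. \<forall>i. cmod (x \<eta> i) * real (Suc i) ^ n \<le> K"
    using smoothing_bound[OF assms(1) \<open>n \<ge> 1\<close> m(1)] by metis
qed

lemma smoothing_expansion:
  assumes "smoothing x" "\<eta> \<in> s_dual"
  shows "(\<lambda>j. \<eta> j * x (unit_seq j) i) sums x \<eta> i"
proof -
  obtain m where m: "m \<ge> 1" "dual_finite m \<eta>"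
    using assms by (auto simp: s_dual_iff)
  obtain K where K: "\<And>\<eta> i. dual_finite m \<eta> \<Longrightarrow> cmod (x \<eta> i) * real (Suc i) ^ 1 \<le> K * dnorm m \<eta>"
    using smoothing_bound[OF assms(1) order_refl m(1)] by metis
  show ?thesis
  proof (rule functional_expansion[where F = "\<lambda>\<eta>. x \<eta> i", OF _ _ _ m])
    fix \<zeta> assume "dual_finite m \<zeta>"
    have "cmod (x \<zeta> i) * 1 \<le> cmod (x \<zeta> i) * real (Suc i)"
      by (intro mult_left_mono) auto
    also have "\<dots> \<le> K * dnorm m \<zeta>"
      using K[OF \<open>dual_finite m \<zeta>\<close>, of i] by simp
    finally show "cmod (x \<zeta> i) \<le> K * dnorm m \<zeta>" by simp
  qed (simp_all add: smoothing_add[OF assms(1)] smoothing_cmult[OF assms(1)])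
qed

text \<open>A bounded subset of s is bounded in every norm. Pairing it with \<eta> is therefore
  controlled by \<open>dnorm m \<eta>\<close> for each \<open>m\<close>, whatever \<open>n\<close>
  was used to obtain the set. This makes the two indices independent, as for rapidly decreasing
  matrices.\<close>

lemma NCS_smoothing:
  assumes x: "x \<in> NCS"
  shows "smoothing x"
  unfolding smoothing_def
proof (intro conjI allI impI)
  show "\<forall>\<eta>\<in>s_dual. \<forall>\<eta>'\<in>s_dual. x (\<lambda>j. \<eta> j + \<eta>' j) = (\<lambda>j. x \<eta> j + x \<eta>' j)"
    "\<forall>\<eta>\<in>s_dual. \<forall>c. x (\<lambda>j. c * \<eta> j) = (\<lambda>j. c * x \<eta> j)"
    using x by (auto simp: NCS_def)
  fix n m :: nat assume n: "n \<ge> 1" and m: "m \<ge> 1"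
  obtain B C where B: "s_bounded B"
    and C: "\<And>\<eta>. \<eta> \<in> s_dual \<Longrightarrow> snorm n (x \<eta>) \<le> C * Sup ((\<lambda>\<xi>. cmod (pairing \<xi> \<eta>)) ` B)"
    using x n unfolding NCS_def continuous_op_def by blast
  have entry: "cmod (x \<eta> i) * real (Suc i) ^ n \<le> C * Sup ((\<lambda>\<xi>. cmod (pairing \<xi> \<eta>)) ` B)"
    if "\<eta> \<in> s_dual" for \<eta> i
    using norm_entry_le_snorm[OF n, of "x \<eta>" i] C[OF that] x that by (fastforce simp: NCS_def)
  show "\<exists>K. \<forall>\<eta> i. dual_finite m \<eta> \<longrightarrow> cmod (x \<eta> i) * real (Suc i) ^ n \<le> K * dnorm m \<eta>"
  proof (cases "B = {}")
    case True
    \<comment> \<open>\<open>Sup {}\<close> is an unspecified constant, but homogeneity still forces \<open>x = 0\<close>.\<close>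
    have "cmod (x \<eta> i) * real (Suc i) ^ n \<le> 0" if \<eta>: "\<eta> \<in> s_dual" for \<eta> i
    proof (rule ccontr)
      define e where "e = cmod (x \<eta> i) * real (Suc i) ^ n"
      assume "\<not> cmod (x \<eta> i) * real (Suc i) ^ n \<le> 0"
      then have e: "e > 0" by (simp add: e_def)
      \<comment> \<open>Scaling by this factor raises the entry to one more than the constant that
        should bound it.\<close>
      define t where "t = (\<bar>C * Sup {}\<bar> + 1) / e"
      have "t \<ge> 0" using e by (simp add: t_def)
      have "x (\<lambda>j. of_real t * \<eta> j) = (\<lambda>j. of_real t * x \<eta> j)"
        using x \<eta> by (simp add: NCS_def)
      then have "t * e \<le> C * Sup {}"
        using entry[OF s_dual_cmult[OF \<eta>], of "of_real t" i] \<open>t \<ge> 0\<close> True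
        by (simp add: norm_mult e_def mult_ac del: of_nat_Suc)
      moreover have "t * e = \<bar>C * Sup {}\<bar> + 1"
        using e by (simp add: t_def)
      ultimately show False by linarith
    qed
    then show ?thesis
      using s_dualI[OF m] by (intro exI[of _ 0]) auto
  next
    case False
    obtain M where M: "\<And>\<xi>. \<xi> \<in> B \<Longrightarrow> snorm m \<xi> \<le> M"
      using B m unfolding s_bounded_def bdd_above_def by blast
    have "cmod (x \<eta> i) * real (Suc i) ^ n \<le> \<bar>C\<bar> * M * dnorm m \<eta>" if "dual_finite m \<eta>" for \<eta> i
    proof -
      \<comment> \<open>The sign of \<open>C\<close> is unknown, so the supremum is bounded in
        absolute value before multiplying.\<close>
      have "\<bar>Sup ((\<lambda>\<xi>. cmod (pairing \<xi> \<eta>)) ` B)\<bar> \<le> M * dnorm m \<eta>"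
      proof (rule cSup_abs_le)
        fix r assume "r \<in> (\<lambda>\<xi>. cmod (pairing \<xi> \<eta>)) ` B"
        then obtain \<xi> where \<xi>: "\<xi> \<in> B" "r = cmod (pairing \<xi> \<eta>)" by auto
        then have "r \<le> snorm m \<xi> * dnorm m \<eta>"
          using pairing_bound(2)[OF m _ that] B by (auto simp: s_bounded_def)
        also have "\<dots> \<le> M * dnorm m \<eta>"
          by (intro mult_right_mono M \<xi> dnorm_nonneg that)
        finally show "\<bar>r\<bar> \<le> M * dnorm m \<eta>" using \<xi> by simp
      qed (use False in auto)
      then have "C * Sup ((\<lambda>\<xi>. cmod (pairing \<xi> \<eta>)) ` B) \<le> \<bar>C\<bar> * (M * dnorm m \<eta>)"
        by - (rule order_trans[OF abs_ge_self], simp add: abs_mult mult_left_mono)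
      then show ?thesis
        using entry[OF s_dualI[OF m that], of i] by (simp add: mult_ac)
    qed
    then show ?thesis by blast
  qed
qed

section \<open>Pairing identities and the adjoint\<close>

lemma pairing_dual_bound:
  assumes "n \<ge> 1" "\<xi> \<in> s_space" "dual_finite n \<eta>"
  shows "cmod (pairing \<eta> \<xi>) \<le> snorm n \<xi> * dnorm n \<eta>"
  using pairing_bound(2)[OF assms] by (simp add: pairing_cnj[OF assms])

lemma summable_pairing:
  assumes "\<xi> \<in> s_space" "\<eta> \<in> s_dual"
  shows "summable (\<lambda>j. \<xi> j * cnj (\<eta> j))" "summable (\<lambda>j. \<eta> j * cnj (\<xi> j))"
proof -
  obtain n where n: "n \<ge> 1" "dual_finite n \<eta>"
    using assms by (auto simp: s_dual_iff)
  show 1: "summable (\<lambda>j. \<xi> j * cnj (\<eta> j))"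
    by (rule pairing_bound(1)[OF n(1) assms(1) n(2)])
  have "(\<lambda>j. cnj (\<xi> j * cnj (\<eta> j))) sums cnj (\<Sum>j. \<xi> j * cnj (\<eta> j))"
    unfolding sums_cnj by (rule summable_sums[OF 1])
  then show "summable (\<lambda>j. \<eta> j * cnj (\<xi> j))"
    by (simp add: sums_iff mult.commute)
qed

lemma pairing_add_left:
  assumes "summable (\<lambda>j. a j * cnj (c j))" "summable (\<lambda>j. b j * cnj (c j))"
  shows "pairing (\<lambda>j. a j + b j) c = pairing a c + pairing b c"
  unfolding pairing_def distrib_right by (rule suminf_add[OF assms, symmetric])

lemma pairing_cmult_left:
  assumes "summable (\<lambda>j. a j * cnj (b j))"
  shows "pairing (\<lambda>j. c * a j) b = c * pairing a b"
  unfolding pairing_def mult.assoc by (rule suminf_mult[OF assms])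

lemma pairing_unit_seq: "pairing v (unit_seq j) = v j"
proof -
  have "(\<lambda>i. v i * cnj (unit_seq j i)) = (\<lambda>i. if i = j then v i else 0)"
    by auto
  then show ?thesis
    unfolding pairing_def using sums_unique[OF sums_single[of j v]] by simp
qed

text \<open>Testing against unit sequences dictates the entries of \<open>v\<close>. They decay
  rapidly because \<open>unit_seq j\<close> has dual norm \<open>1 / (j+1)^n\<close> for every
  \<open>n\<close> and \<open>x\<close> is bounded from each dual norm into the norm that pairs with
  \<xi>.\<close>

lemma adjoint_exists:
  assumes x: "smoothing x" and \<xi>: "\<xi> \<in> s_dual"
  defines "v \<equiv> \<lambda>j. pairing \<xi> (x (unit_seq j))"
  shows "v \<in> s_space" and "\<And>\<eta>. \<eta> \<in> s_dual \<Longrightarrow> pairing v \<eta> = pairing \<xi> (x \<eta>)"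
proof -
  obtain q where q: "q \<ge> 1" "dual_finite q \<xi>"
    using \<xi> by (auto simp: s_dual_iff)
  have bound: "cmod (pairing \<xi> (x \<eta>)) \<le> snorm q (x \<eta>) * dnorm q \<xi>" if "\<eta> \<in> s_dual" for \<eta>
    by (rule pairing_dual_bound[OF q(1) smoothing_s_space[OF x that] q(2)])
  show "v \<in> s_space"
  proof (rule s_space_of_entries)
    fix n :: nat assume n: "n \<ge> 1"
    obtain K where K: "K \<ge> 0" "\<And>\<eta>. dual_finite n \<eta> \<Longrightarrow> snorm q (x \<eta>) \<le> K * dnorm n \<eta>"
      using smoothing_snorm_bound[OF x n] by metis
    have "cmod (v j) * real (Suc j) ^ n \<le> K * dnorm q \<xi>" for j
    proof -
      have "cmod (v j) \<le> snorm q (x (unit_seq j)) * dnorm q \<xi>"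
        unfolding v_def by (rule bound) simp
      also have "\<dots> \<le> K * dnorm n (unit_seq j) * dnorm q \<xi>"
        by (intro mult_right_mono K(2) unit_seq_dual(1) dnorm_nonneg q)
      finally have "cmod (v j) \<le> K * dnorm q \<xi> / real (Suc j) ^ n"
        by (simp add: unit_seq_dual(2) del: of_nat_Suc)
      then show ?thesis
        by (simp add: pos_le_divide_eq del: of_nat_Suc)
    qed
    then show "\<exists>K. \<forall>i. cmod (v i) * real (Suc i) ^ n \<le> K" by blast
  qed
  fix \<eta> assume \<eta>: "\<eta> \<in> s_dual"
  then obtain m where m: "m \<ge> 1" "dual_finite m \<eta>"
    by (auto simp: s_dual_iff)
  obtain K where K: "K \<ge> 0" "\<And>\<zeta>. dual_finite m \<zeta> \<Longrightarrow> snorm q (x \<zeta>) \<le> K * dnorm m \<zeta>"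
    using smoothing_snorm_bound[OF x m(1)] by metis
  \<comment> \<open>The pairing is conjugate linear in its second slot. The expansion is therefore
    made with the slots exchanged, where it is linear in \<eta>, and conjugated afterwards.\<close>
  have "(\<lambda>j. \<eta> j * pairing (x (unit_seq j)) \<xi>) sums pairing (x \<eta>) \<xi>"
  proof (rule functional_expansion[where F = "\<lambda>\<eta>. pairing (x \<eta>) \<xi>", OF _ _ _ m])
    fix \<zeta> assume \<zeta>: "dual_finite m \<zeta>"
    have "cmod (pairing (x \<zeta>) \<xi>) \<le> snorm q (x \<zeta>) * dnorm q \<xi>"
      by (intro pairing_bound(2) q smoothing_s_space x s_dualI[OF m(1) \<zeta>])
    also have "\<dots> \<le> K * dnorm m \<zeta> * dnorm q \<xi>"
      by (intro mult_right_mono K(2) \<zeta> dnorm_nonneg q)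
    finally show "cmod (pairing (x \<zeta>) \<xi>) \<le> (K * dnorm q \<xi>) * dnorm m \<zeta>"
      by (simp add: mult_ac)
  qed (simp_all add: smoothing_add[OF x] smoothing_cmult[OF x] pairing_add_left pairing_cmult_left
        summable_pairing smoothing_s_space[OF x] \<xi>)
  moreover have "pairing (x \<zeta>) \<xi> = cnj (pairing \<xi> (x \<zeta>))" if "\<zeta> \<in> s_dual" for \<zeta>
    using pairing_cnj[OF q(1) smoothing_s_space[OF x that] q(2)] by simp
  ultimately have "(\<lambda>j. \<eta> j * cnj (v j)) sums cnj (pairing \<xi> (x \<eta>))"
    using \<eta> by (simp add: v_def)
  then have "(\<lambda>j. cnj (\<eta> j * cnj (v j))) sums cnj (cnj (pairing \<xi> (x \<eta>)))"
    by (subst sums_cnj)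
  then show "pairing v \<eta> = pairing \<xi> (x \<eta>)"
    by (simp add: pairing_def[of v] sums_iff mult.commute)
qed

text \<open>The definite description is resolved: existence is \<open>adjoint_exists\<close>, and
  pairing with unit sequences recovers every entry, which gives uniqueness.\<close>

lemma op_adj_eq:
  assumes "smoothing x" "\<xi> \<in> s_dual"
  shows "op_adj x \<xi> = (\<lambda>j. pairing \<xi> (x (unit_seq j)))"
proof -
  let ?v = "\<lambda>j. pairing \<xi> (x (unit_seq j))"
  have "(THE v. v \<in> s_space \<and> (\<forall>\<eta>\<in>s_dual. pairing v \<eta> = pairing \<xi> (x \<eta>))) = ?v"
  proof (rule the_equality)
    show "?v \<in> s_space \<and> (\<forall>\<eta>\<in>s_dual. pairing ?v \<eta> = pairing \<xi> (x \<eta>))"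
      using adjoint_exists[OF assms] by blast
    show "v = ?v" if "v \<in> s_space \<and> (\<forall>\<eta>\<in>s_dual. pairing v \<eta> = pairing \<xi> (x \<eta>))" for v
      using that by (auto simp flip: pairing_unit_seq[of v])
  qed
  then show ?thesis
    using assms by (simp add: op_adj_def)
qed

text \<open>Duality exchanges the indices: decay of order \<open>n\<close> on inputs of dual index
  \<open>m\<close> comes from the bound of \<open>x\<close> from dual index \<open>n\<close> into
  index \<open>m\<close>, evaluated at unit sequences.\<close>

lemma smoothing_adj:
  assumes x: "smoothing x"
  shows "smoothing (op_adj x)"
  unfolding smoothing_def
proof (intro conjI ballI allI impI)
  fix \<eta> assume \<eta>: "\<eta> \<in> s_dual"
  show "op_adj x (\<lambda>j. \<eta> j + \<eta>' j) = (\<lambda>j. op_adj x \<eta> j + op_adj x \<eta>' j)" if "\<eta>' \<in> s_dual" for \<eta>'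
    by (simp add: op_adj_eq[OF x] s_dual_add \<eta> that pairing_add_left summable_pairing
        smoothing_s_space[OF x])
  show "op_adj x (\<lambda>j. c * \<eta> j) = (\<lambda>j. c * op_adj x \<eta> j)" for c
    by (simp add: op_adj_eq[OF x] s_dual_cmult \<eta> pairing_cmult_left summable_pairing
        smoothing_s_space[OF x])
next
  fix n m :: nat assume n: "n \<ge> 1" and m: "m \<ge> 1"
  obtain K where K: "K \<ge> 0" "\<And>\<eta>. dual_finite n \<eta> \<Longrightarrow> snorm m (x \<eta>) \<le> K * dnorm n \<eta>"
    using smoothing_snorm_bound[OF x n] by metis
  have "cmod (op_adj x \<eta> j) * real (Suc j) ^ n \<le> K * dnorm m \<eta>" if \<eta>: "dual_finite m \<eta>" for \<eta> j
  proof -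
    have "cmod (op_adj x \<eta> j) \<le> snorm m (x (unit_seq j)) * dnorm m \<eta>"
      by (simp add: op_adj_eq[OF x s_dualI[OF m \<eta>]] pairing_dual_bound[OF m _ \<eta>]
          smoothing_s_space[OF x])
    also have "\<dots> \<le> K * dnorm n (unit_seq j) * dnorm m \<eta>"
      by (intro mult_right_mono K(2) unit_seq_dual(1) dnorm_nonneg \<eta>)
    finally have "cmod (op_adj x \<eta> j) \<le> K * dnorm m \<eta> / real (Suc j) ^ n"
      by (simp add: unit_seq_dual(2) del: of_nat_Suc)
    then show ?thesis
      by (simp add: pos_le_divide_eq del: of_nat_Suc)
  qed
  then show "\<exists>K. \<forall>\<eta> i. dual_finite m \<eta> \<longrightarrow> cmod (op_adj x \<eta> i) * real (Suc i) ^ n \<le> K * dnorm m \<eta>"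
    by blast
qed

text \<open>The inner operator lands in s with control of the norm of index 1, which dominates the
  dual norm of index 1 on which the outer operator is bounded.\<close>

lemma smoothing_mult:
  assumes x: "smoothing x" and y: "smoothing y"
  shows "smoothing (op_mult x y)"
  unfolding smoothing_def op_mult_def
proof (intro conjI ballI allI impI)
  fix \<eta> assume \<eta>: "\<eta> \<in> s_dual"
  have y_dual: "y \<zeta> \<in> s_dual" if "\<zeta> \<in> s_dual" for \<zeta>
    using smoothing_s_space[OF y that] by (rule s_space_subset_s_dual)
  show "x (y (\<lambda>j. \<eta> j + \<eta>' j)) = (\<lambda>j. x (y \<eta>) j + x (y \<eta>') j)" if "\<eta>' \<in> s_dual" for \<eta>'
    by (simp add: smoothing_add[OF x] smoothing_add[OF y] \<eta> that y_dual)
  show "x (y (\<lambda>j. c * \<eta> j)) = (\<lambda>j. c * x (y \<eta>) j)" for c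
    by (simp add: smoothing_cmult[OF x] smoothing_cmult[OF y] \<eta> y_dual)
next
  fix n m :: nat assume n: "n \<ge> 1" and m: "m \<ge> 1"
  obtain K where K: "K \<ge> 0"
      "\<And>\<eta> i. dual_finite 1 \<eta> \<Longrightarrow> cmod (x \<eta> i) * real (Suc i) ^ n \<le> K * dnorm 1 \<eta>"
    using smoothing_bound[OF x n order_refl] by metis
  obtain L where L: "L \<ge> 0" "\<And>\<eta>. dual_finite m \<eta> \<Longrightarrow> snorm 1 (y \<eta>) \<le> L * dnorm m \<eta>"
    using smoothing_snorm_bound[OF y m] by metis
  have "cmod (x (y \<eta>) i) * real (Suc i) ^ n \<le> (K * L) * dnorm m \<eta>" if \<eta>: "dual_finite m \<eta>" for \<eta> i
  proof -
    note y_space = smoothing_s_space[OF y s_dualI[OF m \<eta>]]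
    have "cmod (x (y \<eta>) i) * real (Suc i) ^ n \<le> K * dnorm 1 (y \<eta>)"
      by (intro K s_space_dual_finite y_space order_refl)
    also have "\<dots> \<le> K * (L * dnorm m \<eta>)"
      using s_space_dual_finite(2)[OF y_space order_refl] L(2)[OF \<eta>] K(1)
      by (intro mult_left_mono) auto
    finally show ?thesis by (simp add: mult_ac)
  qed
  then show "\<exists>K. \<forall>\<eta> i. dual_finite m \<eta> \<longrightarrow> cmod (x (y \<eta>) i) * real (Suc i) ^ n \<le> K * dnorm m \<eta>"
    by blast
qed

lemma smoothing_linear_combination:
  assumes x: "\<And>l. l < N \<Longrightarrow> smoothing (x l)"
  shows "smoothing (\<lambda>\<eta> i. \<Sum>l<(N::nat). c l * x l \<eta> i)"
  unfolding smoothing_def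
proof (intro conjI ballI allI impI)
  fix \<eta> assume \<eta>: "\<eta> \<in> s_dual"
  show "(\<lambda>i. \<Sum>l<N. c l * x l (\<lambda>j. \<eta> j + \<eta>' j) i)
      = (\<lambda>j. (\<Sum>l<N. c l * x l \<eta> j) + (\<Sum>l<N. c l * x l \<eta>' j))" if "\<eta>' \<in> s_dual" for \<eta>'
    by (auto simp: smoothing_add[OF x] \<eta> that distrib_left simp flip: sum.distrib intro!: sum.cong)
  show "(\<lambda>i. \<Sum>l<N. c l * x l (\<lambda>j. d * \<eta> j) i) = (\<lambda>j. d * (\<Sum>l<N. c l * x l \<eta> j))" for d
    by (auto simp: smoothing_cmult[OF x] \<eta> sum_distrib_left mult_ac intro!: sum.cong)
next
  fix n m :: nat assume n: "n \<ge> 1" and m: "m \<ge> 1"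
  have "\<forall>l\<in>{..<N}. \<exists>K. \<forall>\<eta> i. dual_finite m \<eta> \<longrightarrow> cmod (x l \<eta> i) * real (Suc i) ^ n \<le> K * dnorm m \<eta>"
    using x n m unfolding smoothing_def by blast
  then obtain K where K: "\<And>l \<eta> i. l < N \<Longrightarrow> dual_finite m \<eta> \<Longrightarrow>
      cmod (x l \<eta> i) * real (Suc i) ^ n \<le> K l * dnorm m \<eta>"
    by (metis lessThan_iff)
  have "cmod (\<Sum>l<N. c l * x l \<eta> i) * real (Suc i) ^ n \<le> (\<Sum>l<N. cmod (c l) * K l) * dnorm m \<eta>"
    if "dual_finite m \<eta>" for \<eta> i
  proof -
    have "cmod (\<Sum>l<N. c l * x l \<eta> i) * real (Suc i) ^ n
        \<le> (\<Sum>l<N. cmod (c l * x l \<eta> i)) * real (Suc i) ^ n"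
      by (intro mult_right_mono norm_sum) simp
    also have "\<dots> = (\<Sum>l<N. cmod (c l) * (cmod (x l \<eta> i) * real (Suc i) ^ n))"
      by (simp add: sum_distrib_left sum_distrib_right norm_mult mult_ac)
    also have "\<dots> \<le> (\<Sum>l<N. cmod (c l) * (K l * dnorm m \<eta>))"
      by (intro sum_mono mult_left_mono K that) auto
    finally show ?thesis by (simp add: sum_distrib_left sum_distrib_right mult_ac)
  qed
  then show "\<exists>K. \<forall>\<eta> i. dual_finite m \<eta> \<longrightarrow>
      cmod (\<Sum>l<N. c l * x l \<eta> i) * real (Suc i) ^ n \<le> K * dnorm m \<eta>"
    by blast
qed

lemma smoothing_absq:
  assumes "smoothing x"
  shows "smoothing (op_absq x)"
proof -
  define y where "y = (\<lambda>l::nat. if l = 0 then op_mult (op_adj x) x else op_mult x (op_adj x))"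
  have "smoothing (\<lambda>\<eta> i. \<Sum>l<(2::nat). (1 / 2) * y l \<eta> i)"
    by (rule smoothing_linear_combination)
      (auto simp: y_def intro: smoothing_mult smoothing_adj assms)
  also have "(\<lambda>\<eta> i. \<Sum>l<(2::nat). (1 / 2) * y l \<eta> i) = op_absq x"
    by (auto simp: y_def op_absq_def fun_eq_iff numeral_2_eq_2)
  finally show ?thesis .
qed

lemma smoothing_sum_absq:
  assumes "\<And>l. l < N \<Longrightarrow> smoothing (X l)"
  shows "smoothing (sum_absq N X)"
proof -
  have "sum_absq N X = (\<lambda>\<eta> i. \<Sum>l<N. 1 * op_absq (X l) \<eta> i)"
    by (simp add: sum_absq_def)
  then show ?thesis
    using smoothing_linear_combination[of N "\<lambda>l. op_absq (X l)" "\<lambda>_. 1"] assms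
    by (simp add: smoothing_absq)
qed

section \<open>Operator norms\<close>

text \<open>The smoothing bound makes the set of values bounded above, so the supremum in
  \<open>opnorm\<close> is a genuine one.\<close>

lemma opnorm_upper:
  assumes x: "smoothing x" and n: "n \<ge> 1" and \<eta>: "dual_finite n \<eta>" "dnorm n \<eta> \<le> 1"
  shows "snorm n (x \<eta>) \<le> opnorm n x"
proof -
  obtain K where K: "K \<ge> 0" "\<And>\<eta>. dual_finite n \<eta> \<Longrightarrow> snorm n (x \<eta>) \<le> K * dnorm n \<eta>"
    using smoothing_snorm_bound[OF x n] by metis
  have "bdd_above {snorm n (x \<xi>) | \<xi>. \<xi> \<in> s_dual \<and> dual_finite n \<xi> \<and> dnorm n \<xi> \<le> 1}"
    unfolding bdd_above_def
  proof (intro exI[of _ K] ballI, clarify)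
    fix \<xi> assume "dual_finite n \<xi>" "dnorm n \<xi> \<le> 1"
    then show "snorm n (x \<xi>) \<le> K"
      using K(2)[of \<xi>] mult_left_mono[of "dnorm n \<xi>" 1 K] K(1) by simp
  qed
  then show ?thesis
    unfolding opnorm_def using \<eta> s_dualI[OF n \<eta>(1)] by (intro cSup_upper) auto
qed

lemma opnorm_bound:
  assumes x: "smoothing x" and n: "n \<ge> 1" and \<eta>: "dual_finite n \<eta>"
  shows "snorm n (x \<eta>) \<le> opnorm n x * dnorm n \<eta>"
proof (cases "dnorm n \<eta> = 0")
  \<comment> \<open>Normalising \<eta> is impossible here; the smoothing bound already forces the
    left side to be at most 0.\<close>
  case True
  obtain K where "K \<ge> 0" "\<And>\<eta>. dual_finite n \<eta> \<Longrightarrow> snorm n (x \<eta>) \<le> K * dnorm n \<eta>"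
    using smoothing_snorm_bound[OF x n] by metis
  then show ?thesis
    using True \<eta> by force
next
  case False
  define d where "d = dnorm n \<eta>"
  have d: "d > 0" using False dnorm_nonneg[OF \<eta>] by (simp add: d_def)
  have "dnorm n (\<lambda>j. of_real (1 / d) * \<eta> j) = 1"
    unfolding dual_finite_cmult(2)[OF \<eta>] using d by (simp add: norm_divide flip: d_def)
  then have le: "snorm n (x (\<lambda>j. of_real (1 / d) * \<eta> j)) \<le> opnorm n x"
    by (intro opnorm_upper x n dual_finite_cmult(1) \<eta>) simp
  have s: "summable (\<lambda>j. (cmod (x \<eta> j) * real (Suc j) ^ n)\<^sup>2)"
    using smoothing_s_space[OF x s_dualI[OF n \<eta>]] n by (simp add: s_space_alt)
  have eq: "(cmod (of_real (1 / d) * x \<eta> j) * real (Suc j) ^ n)\<^sup>2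
      = (1 / d)\<^sup>2 * (cmod (x \<eta> j) * real (Suc j) ^ n)\<^sup>2" for j
    using d by (simp add: norm_mult norm_divide power_mult_distrib power_divide)
  have "snorm n (x (\<lambda>j. of_real (1 / d) * \<eta> j)) = snorm n (x \<eta>) / d"
    unfolding smoothing_cmult[OF x s_dualI[OF n \<eta>]] snorm_alt eq suminf_mult[OF s]
    using d by (simp add: real_sqrt_mult real_sqrt_divide)
  then show ?thesis
    using le d by (simp add: pos_divide_le_eq d_def)
qed

lemma zero_seq_dual: "dual_finite n (\<lambda>_. 0)" "dnorm n (\<lambda>_. 0) = 0"
  by (simp_all add: dual_finite_def dnorm_def)

lemma opnorm_nonneg:
  assumes "smoothing x" "n \<ge> 1"
  shows "opnorm n x \<ge> 0"
  using opnorm_upper[OF assms zero_seq_dual(1)] zero_seq_dual(2)[of n]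
    snorm_nonneg[OF assms(2) smoothing_s_space[OF assms(1) s_dualI[OF assms(2) zero_seq_dual(1)]]]
  by simp

lemma opnorm_le:
  assumes "n \<ge> 1" "\<And>\<eta>. dual_finite n \<eta> \<Longrightarrow> dnorm n \<eta> \<le> 1 \<Longrightarrow> snorm n (x \<eta>) \<le> c"
  shows "opnorm n x \<le> c"
  unfolding opnorm_def
proof (rule cSup_least)
  have "(\<lambda>_. 0) \<in> s_dual"
    by (rule s_dualI[OF assms(1) zero_seq_dual(1)])
  then show "{snorm n (x \<xi>) | \<xi>. \<xi> \<in> s_dual \<and> dual_finite n \<xi> \<and> dnorm n \<xi> \<le> 1} \<noteq> {}"
    using zero_seq_dual[of n] by force
qed (use assms in auto)

section \<open>Diagonal entries and the Hilbert--Schmidt estimate\<close>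

lemma pairing_unit_seq_left: "pairing (unit_seq j) v = cnj (v j)"
proof -
  have "(\<lambda>i. unit_seq j i * cnj (v i)) = (\<lambda>i. if i = j then cnj (v i) else 0)"
    by auto
  then show ?thesis
    unfolding pairing_def using sums_unique[OF sums_single[of j "\<lambda>i. cnj (v i)"]] by simp
qed

text \<open>With \<open>x (unit_seq j) i\<close> read as the matrix entry in row \<open>i\<close>
  and column \<open>j\<close>, adjoint times \<open>x\<close> has the squared column norms on its
  diagonal, and \<open>x\<close> times adjoint the squared row norms.\<close>

lemma op_absq_diagonal:
  assumes x: "smoothing x"
  shows "summable (\<lambda>i. (cmod (x (unit_seq a) i))\<^sup>2)"
    and "summable (\<lambda>i. (cmod (x (unit_seq i) a))\<^sup>2)"
    and "op_absq x (unit_seq a) a =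
      of_real (((\<Sum>i. (cmod (x (unit_seq a) i))\<^sup>2) + (\<Sum>i. (cmod (x (unit_seq i) a))\<^sup>2)) / 2)"
proof -
  let ?col = "\<lambda>i. (cmod (x (unit_seq a) i))\<^sup>2" and ?row = "\<lambda>i. (cmod (x (unit_seq i) a))\<^sup>2"
  have col_space: "x (unit_seq a) \<in> s_space"
    by (rule smoothing_s_space[OF x]) simp
  have "(\<lambda>i. x (unit_seq a) i * cnj (x (unit_seq a) i)) sums op_mult (op_adj x) x (unit_seq a) a"
    unfolding op_mult_def op_adj_eq[OF x s_space_subset_s_dual[OF col_space]] pairing_def
    by (intro summable_sums summable_pairing col_space s_space_subset_s_dual)
  then have 1: "(\<lambda>i. complex_of_real (?col i)) sums op_mult (op_adj x) x (unit_seq a) a"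
    by (simp only: complex_norm_square)
  have adj_space: "op_adj x (unit_seq a) \<in> s_dual"
    by (rule s_space_subset_s_dual[OF smoothing_s_space[OF smoothing_adj[OF x] unit_seq_s_dual]])
  have "op_adj x (unit_seq a) j = cnj (x (unit_seq j) a)" for j
    by (simp only: op_adj_eq[OF x unit_seq_s_dual] pairing_unit_seq_left)
  then have "(\<lambda>j. cnj (x (unit_seq j) a) * x (unit_seq j) a) sums op_mult x (op_adj x) (unit_seq a) a"
    using smoothing_expansion[OF x adj_space, of a] by (simp only: op_mult_def)
  then have 2: "(\<lambda>i. complex_of_real (?row i)) sums op_mult x (op_adj x) (unit_seq a) a"
    by (simp only: complex_norm_square mult.commute[of "cnj z" for z])
  show s1: "summable ?col"
    using sums_summable[OF sums_Re[OF 1]] by simp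
  show s2: "summable ?row"
    using sums_summable[OF sums_Re[OF 2]] by simp
  have "op_mult (op_adj x) x (unit_seq a) a = of_real (suminf ?col)"
    using sums_unique2[OF 1] sums_of_real[OF summable_sums[OF s1], where 'a = complex] by blast
  moreover have "op_mult x (op_adj x) (unit_seq a) a = of_real (suminf ?row)"
    using sums_unique2[OF 2] sums_of_real[OF summable_sums[OF s2], where 'a = complex] by blast
  ultimately show "op_absq x (unit_seq a) a = of_real ((suminf ?col + suminf ?row) / 2)"
    by (simp add: op_absq_def)
qed

text \<open>Testing on \<open>unit_seq a\<close> yields one factor \<open>(a+1)^k\<close> from the
  dual norm of the input and another from the weight of the output entry.\<close>

lemma diagonal_le_opnorm:
  assumes "smoothing x" "k \<ge> 1"
  shows "cmod (x (unit_seq a) a) * real (Suc a) ^ (2 * k) \<le> opnorm k x"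
proof -
  have "cmod (x (unit_seq a) a) * real (Suc a) ^ k \<le> snorm k (x (unit_seq a))"
    by (rule norm_entry_le_snorm[OF assms(2) smoothing_s_space[OF assms(1) unit_seq_s_dual]])
  also have "\<dots> \<le> opnorm k x / real (Suc a) ^ k"
    using opnorm_bound[OF assms unit_seq_dual(1), of a] by (simp add: unit_seq_dual(2) del: of_nat_Suc)
  finally show ?thesis
    by (simp add: pos_le_divide_eq mult_2 power_add mult.assoc del: of_nat_Suc)
qed

text \<open>The operator norm is at most the Hilbert--Schmidt norm of the weighted matrix, and the
  mixed weights are moved onto rows and columns separately. The argument uses finite square
  truncations, so no infinite double sum has to be rearranged.\<close>

lemma opnorm_power2_le_absq_diagonal:
  assumes x: "smoothing x" and n: "n \<ge> 1"
    and W: "summable (\<lambda>a. real (Suc a) ^ (4 * n) * Re (op_absq x (unit_seq a) a))"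
  shows "(opnorm n x)\<^sup>2 \<le> (\<Sum>a. real (Suc a) ^ (4 * n) * Re (op_absq x (unit_seq a) a))"
proof -
  define w where "w = (\<lambda>i. real (Suc i) ^ n)"
  define e where "e = (\<lambda>i j. cmod (x (unit_seq j) i))"
  define d where "d = (\<lambda>a. ((\<Sum>i. (e i a)\<^sup>2) + (\<Sum>j. (e a j)\<^sup>2)) / 2)"
  have w_pos: "w i > 0" for i by (simp add: w_def)
  have w4: "real (Suc a) ^ (4 * n) = (w a) ^ 4" for a
    unfolding w_def power_mult[symmetric] by (simp add: mult.commute)
  have W': "summable (\<lambda>a. (w a) ^ 4 * d a)"
    and eqW: "(\<Sum>a. real (Suc a) ^ (4 * n) * Re (op_absq x (unit_seq a) a)) = (\<Sum>a. (w a) ^ 4 * d a)"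
    using W unfolding w4 op_absq_diagonal(3)[OF x] Re_complex_of_real d_def e_def by auto
  have se: "summable (\<lambda>i. (e i a)\<^sup>2)" "summable (\<lambda>j. (e a j)\<^sup>2)" for a
    using op_absq_diagonal(1,2)[OF x, of a] by (simp_all only: e_def)
  have d_ge: "((\<Sum>i<L. (e i a)\<^sup>2) + (\<Sum>j<L. (e a j)\<^sup>2)) / 2 \<le> d a" for a L
    unfolding d_def by (intro divide_right_mono add_mono sum_le_suminf se) auto
  have d_nonneg: "d a \<ge> 0" for a
    using d_ge[where L = 0] by simp
  have HS: "(\<Sum>i<L. \<Sum>j<L. (w i * e i j * w j)\<^sup>2) \<le> (\<Sum>a. (w a) ^ 4 * d a)" for L
  proof -
    have "(\<Sum>i<L. \<Sum>j<L. (w i * e i j * w j)\<^sup>2)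
        \<le> (\<Sum>i<L. \<Sum>j<L. (w i) ^ 4 * (e i j)\<^sup>2 / 2 + (w j) ^ 4 * (e i j)\<^sup>2 / 2)"
    proof (intro sum_mono)
      fix i j
      \<comment> \<open>The arithmetic-geometric mean inequality decouples the row weight from the
        column weight; the factor 1/2 matches the one in the absolute square.\<close>
      have "(w i)\<^sup>2 * (w j)\<^sup>2 \<le> ((w i) ^ 4 + (w j) ^ 4) / 2"
        using sum_squares_bound[of "(w i)\<^sup>2" "(w j)\<^sup>2"] by (simp add: power_mult[symmetric])
      from mult_right_mono[OF this, of "(e i j)\<^sup>2"]
      show "(w i * e i j * w j)\<^sup>2 \<le> (w i) ^ 4 * (e i j)\<^sup>2 / 2 + (w j) ^ 4 * (e i j)\<^sup>2 / 2"
        by (simp add: power_mult_distrib field_simps)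
    qed
    also have "\<dots> = (\<Sum>i<L. \<Sum>j<L. (w i) ^ 4 * (e i j)\<^sup>2 / 2) + (\<Sum>i<L. \<Sum>j<L. (w j) ^ 4 * (e i j)\<^sup>2 / 2)"
      by (simp only: sum.distrib)
    also have "(\<Sum>i<L. \<Sum>j<L. (w j) ^ 4 * (e i j)\<^sup>2 / 2) = (\<Sum>j<L. \<Sum>i<L. (w j) ^ 4 * (e i j)\<^sup>2 / 2)"
      by (rule sum.swap)
    also have "(\<Sum>i<L. \<Sum>j<L. (w i) ^ 4 * (e i j)\<^sup>2 / 2) + (\<Sum>j<L. \<Sum>i<L. (w j) ^ 4 * (e i j)\<^sup>2 / 2)
        = (\<Sum>a<L. (w a) ^ 4 * (((\<Sum>i<L. (e i a)\<^sup>2) + (\<Sum>j<L. (e a j)\<^sup>2)) / 2))"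
      unfolding sum.distrib[symmetric]
      by (intro sum.cong refl)
        (simp add: sum_distrib_left sum_divide_distrib distrib_left add_divide_distrib sum.distrib)
    also have "\<dots> \<le> (\<Sum>a<L. (w a) ^ 4 * d a)"
      by (intro sum_mono mult_left_mono d_ge) (simp add: w_def)
    also have "\<dots> \<le> (\<Sum>a. (w a) ^ 4 * d a)"
      by (intro sum_le_suminf W') (auto intro!: mult_nonneg_nonneg d_nonneg simp: w_def)
    finally show ?thesis .
  qed
  have "opnorm n x \<le> sqrt (\<Sum>a. (w a) ^ 4 * d a)"
  proof (rule opnorm_le[OF n])
    fix \<eta> assume \<eta>: "dual_finite n \<eta>" "dnorm n \<eta> \<le> 1"
    have \<eta>_sum: "(\<Sum>j<L. (cmod (\<eta> j) / w j)\<^sup>2) \<le> 1" for L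
    proof -
      have "(\<Sum>j<L. (cmod (\<eta> j) / w j)\<^sup>2) \<le> (dnorm n \<eta>)\<^sup>2"
        unfolding dnorm_power2[OF \<eta>(1)] w_def
        using \<eta>(1) unfolding dual_finite_alt by (intro sum_le_suminf) auto
      also have "\<dots> \<le> 1"
        using \<eta> dnorm_nonneg[OF \<eta>(1)] by (simp add: power_le_one)
      finally show ?thesis .
    qed
    have partial: "(\<Sum>i<L. (cmod (\<Sum>j<L. \<eta> j * x (unit_seq j) i) * w i)\<^sup>2)
        \<le> (\<Sum>a. (w a) ^ 4 * d a)" for L
    proof -
      have "(cmod (\<Sum>j<L. \<eta> j * x (unit_seq j) i) * w i)\<^sup>2 \<le> (\<Sum>j<L. (w i * e i j * w j)\<^sup>2)" for i
      proof -
        have "cmod (\<Sum>j<L. \<eta> j * x (unit_seq j) i) \<le> (\<Sum>j<L. cmod (\<eta> j * x (unit_seq j) i))"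
          by (rule norm_sum)
        also have "\<dots> = (\<Sum>j<L. (e i j * w j) * (cmod (\<eta> j) / w j))"
          using w_pos by (simp add: norm_mult e_def mult_ac less_imp_neq[symmetric])
        finally have "(cmod (\<Sum>j<L. \<eta> j * x (unit_seq j) i))\<^sup>2
            \<le> (\<Sum>j<L. (e i j * w j) * (cmod (\<eta> j) / w j))\<^sup>2"
          by (intro power_mono) auto
        also have "\<dots> \<le> (\<Sum>j<L. (e i j * w j)\<^sup>2) * (\<Sum>j<L. (cmod (\<eta> j) / w j)\<^sup>2)"
          by (rule Cauchy_Schwarz_ineq_sum)
        also have "\<dots> \<le> (\<Sum>j<L. (e i j * w j)\<^sup>2) * 1"
          by (intro mult_left_mono \<eta>_sum sum_nonneg) auto
        finally have "(cmod (\<Sum>j<L. \<eta> j * x (unit_seq j) i))\<^sup>2 * (w i)\<^sup>2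
            \<le> (\<Sum>j<L. (e i j * w j)\<^sup>2) * (w i)\<^sup>2"
          by (intro mult_right_mono) auto
        then show ?thesis
          by (simp add: power_mult_distrib sum_distrib_right sum_distrib_left mult_ac)
      qed
      then show ?thesis
        by (intro order_trans[OF sum_mono HS]) auto
    qed
    \<comment> \<open>The row cutoff \<open>I\<close> stays fixed while the column cutoff
      \<open>L\<close> grows. For \<open>I \<le> L\<close> the sum is part of the square truncation
      already bounded.\<close>
    have lim: "(\<lambda>L. \<Sum>i<I. (cmod (\<Sum>j<L. \<eta> j * x (unit_seq j) i) * w i)\<^sup>2)
        \<longlonglongrightarrow> (\<Sum>i<I. (cmod (x \<eta> i) * w i)\<^sup>2)" for I
      using smoothing_expansion[OF x s_dualI[OF n \<eta>(1)]] unfolding sums_def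
      by (intro tendsto_intros)
    have "(\<Sum>i<I. (cmod (x \<eta> i) * w i)\<^sup>2) \<le> (\<Sum>a. (w a) ^ 4 * d a)" for I
    proof (rule LIMSEQ_le_const2[OF lim], intro exI[of _ I] allI impI)
      fix L assume "I \<le> L"
      then have "(\<Sum>i<I. (cmod (\<Sum>j<L. \<eta> j * x (unit_seq j) i) * w i)\<^sup>2)
          \<le> (\<Sum>i<L. (cmod (\<Sum>j<L. \<eta> j * x (unit_seq j) i) * w i)\<^sup>2)"
        by (intro sum_mono2) auto
      then show "(\<Sum>i<I. (cmod (\<Sum>j<L. \<eta> j * x (unit_seq j) i) * w i)\<^sup>2)
          \<le> (\<Sum>a. (w a) ^ 4 * d a)"
        using partial[of L] by linarith
    qed
    then show "snorm n (x \<eta>) \<le> sqrt (\<Sum>a. (w a) ^ 4 * d a)"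
      using smoothing_s_space[OF x s_dualI[OF n \<eta>(1)]] n unfolding snorm_alt w_def s_space_alt
      by (intro real_sqrt_le_mono suminf_le_const) auto
  qed
  then have "(opnorm n x)\<^sup>2 \<le> (sqrt (\<Sum>a. (w a) ^ 4 * d a))\<^sup>2"
    by (intro power_mono opnorm_nonneg x n)
  also have "\<dots> = (\<Sum>a. (w a) ^ 4 * d a)"
    by (intro real_sqrt_pow2 suminf_nonneg W' mult_nonneg_nonneg d_nonneg) (simp add: w_def)
  finally show ?thesis
    unfolding eqW .
qed

text \<open>This is where the index \<open>2n+1\<close> enters: its doubled exponent is
  \<open>4n + 2\<close>, and the two powers beyond \<open>4n\<close> make the series over
  \<open>a\<close> converge.\<close>

lemma weight_split:
  assumes "r * real (Suc a) ^ (2 * (2 * n + 1)) \<le> c"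
  shows "real (Suc a) ^ (4 * n) * r \<le> c * (1 / real (Suc a))\<^sup>2"
proof -
  have "2 * (2 * n + 1) = 4 * n + 2" by simp
  then have "real (Suc a) ^ (4 * n) * r * (real (Suc a))\<^sup>2 \<le> c"
    using assms by (simp only: power_add mult_ac)
  then show ?thesis
    by (simp add: power_divide pos_le_divide_eq del: of_nat_Suc)
qed

text \<open>The Hilbert--Schmidt estimate is linear in the diagonal of the absolute square, so the
  estimates for the single operators add up to one for the diagonal of
  \<open>sum_absq\<close>.\<close>

lemma sum_opnorm_power2_le:
  assumes X: "\<And>l. l < m \<Longrightarrow> smoothing (X l)" and n: "n \<ge> 1"
  shows "(\<Sum>l<m. (opnorm n (X l))\<^sup>2) \<le> zeta2 * opnorm (2 * n + 1) (sum_absq m X)"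
proof -
  define W where "W = (\<lambda>l a. real (Suc a) ^ (4 * n) * Re (op_absq (X l) (unit_seq a) a))"
  have W_nonneg: "W l a \<ge> 0" if "l < m" for l a
    unfolding W_def op_absq_diagonal(3)[OF X[OF that]] Re_complex_of_real
    using op_absq_diagonal(1,2)[OF X[OF that]]
    by (intro mult_nonneg_nonneg divide_nonneg_nonneg add_nonneg_nonneg suminf_nonneg) auto
  \<comment> \<open>The norm of each single absolute square serves only to establish convergence; it
    does not enter the final constant.\<close>
  have W: "summable (W l)" if "l < m" for l
  proof (rule summable_comparison_test'[OF summable_mult[OF summable_zeta2]])
    fix a :: nat
    have "Re (op_absq (X l) (unit_seq a) a) * real (Suc a) ^ (2 * (2 * n + 1))
        \<le> opnorm (2 * n + 1) (op_absq (X l))"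
      by (rule order_trans[OF mult_right_mono[OF complex_Re_le_cmod] diagonal_le_opnorm])
        (use smoothing_absq X that in auto)
    then have "W l a \<le> opnorm (2 * n + 1) (op_absq (X l)) * (1 / real (Suc a))\<^sup>2"
      unfolding W_def by (rule weight_split)
    then show "norm (W l a) \<le> opnorm (2 * n + 1) (op_absq (X l)) * (1 / real (Suc a))\<^sup>2"
      using W_nonneg[OF that, of a] by simp
  qed
  have "(\<Sum>l<m. (opnorm n (X l))\<^sup>2) \<le> (\<Sum>l<m. suminf (W l))"
  proof (rule sum_mono)
    fix l assume "l \<in> {..<m}"
    then have "l < m" by simp
    show "(opnorm n (X l))\<^sup>2 \<le> suminf (W l)"
      using opnorm_power2_le_absq_diagonal[OF X[OF \<open>l < m\<close>] n W[OF \<open>l < m\<close>, unfolded W_def]]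
      unfolding W_def .
  qed
  \<comment> \<open>Summing over \<open>l\<close> first lets the diagonal bound be applied to the
    whole sum, which gives the norm of the sum rather than the larger sum of norms.\<close>
  also have "\<dots> = (\<Sum>a. \<Sum>l<m. W l a)"
    using W by (intro suminf_sum[symmetric]) auto
  also have "\<dots> \<le> (\<Sum>a. opnorm (2 * n + 1) (sum_absq m X) * (1 / real (Suc a))\<^sup>2)"
  proof (intro suminf_le summable_mult summable_zeta2 summable_sum)
    fix a :: nat
    have "(\<Sum>l<m. W l a) = real (Suc a) ^ (4 * n) * Re (sum_absq m X (unit_seq a) a)"
      by (simp add: W_def sum_absq_def sum_distrib_left)
    also have "\<dots> \<le> opnorm (2 * n + 1) (sum_absq m X) * (1 / real (Suc a))\<^sup>2"
      by (intro weight_split order_trans[OF mult_right_mono[OF complex_Re_le_cmod] diagonal_le_opnorm]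
          smoothing_sum_absq X) auto
    finally show "(\<Sum>l<m. W l a) \<le> opnorm (2 * n + 1) (sum_absq m X) * (1 / real (Suc a))\<^sup>2" .
  qed (use W in auto)
  also have "\<dots> = zeta2 * opnorm (2 * n + 1) (sum_absq m X)"
    unfolding zeta2_def by (subst suminf_mult[OF summable_zeta2]) simp
  finally show ?thesis .
qed

lemma sum_mult_le_sqrt:
  fixes f g :: "'a \<Rightarrow> real"
  shows "(\<Sum>l\<in>A. f l * g l) \<le> sqrt (\<Sum>l\<in>A. (f l)\<^sup>2) * sqrt (\<Sum>l\<in>A. (g l)\<^sup>2)"
  using real_le_rsqrt[OF Cauchy_Schwarz_ineq_sum[of f g A]] by (simp add: real_sqrt_mult)

lemma sum_opnorm_mult_le:
  assumes X: "\<And>l. l < m \<Longrightarrow> smoothing (X l)" and Y: "\<And>l. l < m \<Longrightarrow> smoothing (Y l)" and n: "n \<ge> 1"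
  shows "(\<Sum>l<m. opnorm n (X l) * opnorm n (Y l)) \<le>
    zeta2 * (sqrt (opnorm (2 * n + 1) (sum_absq m X)) * sqrt (opnorm (2 * n + 1) (sum_absq m Y)))"
proof -
  have "(\<Sum>l<m. opnorm n (X l) * opnorm n (Y l))
      \<le> sqrt (\<Sum>l<m. (opnorm n (X l))\<^sup>2) * sqrt (\<Sum>l<m. (opnorm n (Y l))\<^sup>2)"
    by (rule sum_mult_le_sqrt)
  also have "\<dots> \<le> sqrt (zeta2 * opnorm (2 * n + 1) (sum_absq m X))
      * sqrt (zeta2 * opnorm (2 * n + 1) (sum_absq m Y))"
    by (intro mult_mono real_sqrt_le_mono sum_opnorm_power2_le X Y n real_sqrt_ge_zero sum_nonneg
        mult_nonneg_nonneg opnorm_nonneg smoothing_sum_absq less_imp_le[OF zeta2_pos]) auto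
  also have "\<dots> = zeta2 * (sqrt (opnorm (2 * n + 1) (sum_absq m X)) * sqrt (opnorm (2 * n + 1) (sum_absq m Y)))"
    using zeta2_pos by (simp add: real_sqrt_mult)
  finally show ?thesis .
qed

section \<open>Tensor norms\<close>

text \<open>\<open>NCS_tensor\<close> admits the empty sum while both norms ask for
  \<open>m \<ge> 1\<close>; a nonzero tensor cannot be an empty sum. Hence the infima below range
  over nonempty sets.\<close>

lemma NCS_tensor_representation:
  assumes "z \<in> NCS_tensor" "z \<noteq> (\<lambda>_ _. 0)"
  obtains m X Y where "m \<ge> 1" "\<forall>j<m. X j \<in> NCS \<and> Y j \<in> NCS" "tensor_of m X Y = z"
proof -
  obtain m X Y where z: "z = tensor_of m X Y" "\<forall>j<m. X j \<in> NCS \<and> Y j \<in> NCS"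
    using assms(1) by (auto simp: NCS_tensor_def)
  have "m \<noteq> 0"
  proof
    assume "m = 0"
    then have "z = (\<lambda>_ _. 0)"
      using z(1) by (auto simp: tensor_of_def fun_eq_iff)
    with assms(2) show False by simp
  qed
  then show ?thesis
    using that[of m X Y] z by auto
qed

lemma pi_norm_le:
  assumes "n \<ge> 1" "m \<ge> 1" "\<forall>j<m. X j \<in> NCS \<and> Y j \<in> NCS"
  shows "pi_norm n (tensor_of m X Y) \<le> (\<Sum>j<m. opnorm n (X j) * opnorm n (Y j))"
  unfolding pi_norm_def
proof (rule cInf_lower)
  have "0 \<le> (\<Sum>j<m'. opnorm n (X' j) * opnorm n (Y' j))"
    if "\<forall>j<m'. X' j \<in> NCS \<and> Y' j \<in> NCS" for m' :: nat and X' Y'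
    using that by (intro sum_nonneg mult_nonneg_nonneg opnorm_nonneg NCS_smoothing assms(1)) auto
  then show "bdd_below {(\<Sum>j<m'. opnorm n (X' j) * opnorm n (Y' j)) | m' X' Y'.
       m' \<ge> 1 \<and> (\<forall>j<m'. X' j \<in> NCS \<and> Y' j \<in> NCS) \<and> tensor_of m' X' Y' = tensor_of m X Y}"
    by (intro bdd_belowI[of _ 0]) blast
qed (use assms in blast)

lemma le_pi_norm:
  assumes "z \<in> NCS_tensor" "z \<noteq> (\<lambda>_ _. 0)"
    and "\<And>m X Y. m \<ge> 1 \<Longrightarrow> \<forall>j<m. X j \<in> NCS \<and> Y j \<in> NCS \<Longrightarrow> tensor_of m X Y = z \<Longrightarrow>
      c \<le> (\<Sum>j<m. opnorm n (X j) * opnorm n (Y j))"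
  shows "c \<le> pi_norm n z"
  unfolding pi_norm_def
proof (rule cInf_greatest)
  obtain m X Y where "m \<ge> 1" "\<forall>j<m. X j \<in> NCS \<and> Y j \<in> NCS" "tensor_of m X Y = z"
    by (rule NCS_tensor_representation[OF assms(1,2)])
  then show "{(\<Sum>j<m. opnorm n (X j) * opnorm n (Y j)) | m X Y.
       m \<ge> 1 \<and> (\<forall>j<m. X j \<in> NCS \<and> Y j \<in> NCS) \<and> tensor_of m X Y = z} \<noteq> {}"
    by blast
qed (use assms(3) in blast)

lemma ah_norm_value_nonneg:
  assumes "k \<ge> 1" "\<forall>j<m. X j \<in> NCS \<and> Y j \<in> NCS"
  shows "0 \<le> sqrt (opnorm k (sum_absq m X)) * sqrt (opnorm k (sum_absq m Y))"
  using assms(2)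
  by (intro mult_nonneg_nonneg real_sqrt_ge_zero opnorm_nonneg smoothing_sum_absq NCS_smoothing
      assms(1)) auto

lemma ah_norm_le:
  assumes "k \<ge> 1" "m \<ge> 1" "\<forall>j<m. X j \<in> NCS \<and> Y j \<in> NCS"
  shows "ah_norm k (tensor_of m X Y) \<le> sqrt (opnorm k (sum_absq m X)) * sqrt (opnorm k (sum_absq m Y))"
  unfolding ah_norm_def
proof (rule cInf_lower)
  show "bdd_below {sqrt (opnorm k (sum_absq m' X')) * sqrt (opnorm k (sum_absq m' Y')) | m' X' Y'.
       m' \<ge> 1 \<and> (\<forall>j<m'. X' j \<in> NCS \<and> Y' j \<in> NCS) \<and> tensor_of m' X' Y' = tensor_of m X Y}"
    using ah_norm_value_nonneg[OF assms(1)] by (intro bdd_belowI[of _ 0]) blast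
qed (use assms in blast)

lemma le_ah_norm:
  assumes "z \<in> NCS_tensor" "z \<noteq> (\<lambda>_ _. 0)"
    and "\<And>m X Y. m \<ge> 1 \<Longrightarrow> \<forall>j<m. X j \<in> NCS \<and> Y j \<in> NCS \<Longrightarrow> tensor_of m X Y = z \<Longrightarrow>
      c \<le> sqrt (opnorm k (sum_absq m X)) * sqrt (opnorm k (sum_absq m Y))"
  shows "c \<le> ah_norm k z"
  unfolding ah_norm_def
proof (rule cInf_greatest)
  obtain m X Y where "m \<ge> 1" "\<forall>j<m. X j \<in> NCS \<and> Y j \<in> NCS" "tensor_of m X Y = z"
    by (rule NCS_tensor_representation[OF assms(1,2)])
  then show "{sqrt (opnorm k (sum_absq m X)) * sqrt (opnorm k (sum_absq m Y)) | m X Y.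
       m \<ge> 1 \<and> (\<forall>j<m. X j \<in> NCS \<and> Y j \<in> NCS) \<and> tensor_of m X Y = z} \<noteq> {}"
    by blast
qed (use assms(3) in blast)

lemma pi_norm_le_ah_norm:
  assumes n: "n \<ge> 1" and z: "z \<in> NCS_tensor" "z \<noteq> (\<lambda>_ _. 0)"
  shows "pi_norm n z \<le> zeta2 * ah_norm (2 * n + 1) z"
proof -
  \<comment> \<open>With the constant moved to the left, the claim is a lower bound for an infimum
    and can be checked on each representation.\<close>
  have "pi_norm n z / zeta2 \<le> ah_norm (2 * n + 1) z"
  proof (rule le_ah_norm[OF z])
    fix m :: nat and X Y
    assume rep: "m \<ge> 1" "\<forall>j<m. X j \<in> NCS \<and> Y j \<in> NCS" "tensor_of m X Y = z"
    have "pi_norm n z \<le> (\<Sum>j<m. opnorm n (X j) * opnorm n (Y j))"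
      using pi_norm_le[OF n rep(1,2)] rep(3) by simp
    also have "\<dots> \<le> zeta2 * (sqrt (opnorm (2 * n + 1) (sum_absq m X)) * sqrt (opnorm (2 * n + 1) (sum_absq m Y)))"
      using rep(2) by (intro sum_opnorm_mult_le NCS_smoothing n) auto
    finally show "pi_norm n z / zeta2
        \<le> sqrt (opnorm (2 * n + 1) (sum_absq m X)) * sqrt (opnorm (2 * n + 1) (sum_absq m Y))"
      using zeta2_pos by (simp add: pos_divide_le_eq mult.commute)
  qed
  then show ?thesis
    using zeta2_pos by (simp add: pos_divide_le_eq mult.commute)
qed

lemma ah_norm_nonneg:
  assumes "k \<ge> 1" "z \<in> NCS_tensor" "z \<noteq> (\<lambda>_ _. 0)"
  shows "ah_norm k z \<ge> 0"
  by (rule le_ah_norm[OF assms(2,3) ah_norm_value_nonneg[OF assms(1)]])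

lemma ratio_bounded_upper:
  assumes "n \<ge> 1"
  shows "ratio_bounded n (2 * n + 1)"
  unfolding ratio_bounded_def
proof (rule bdd_aboveI[of _ zeta2], clarify)
  fix z assume z: "z \<in> NCS_tensor" "z \<noteq> (\<lambda>_ _. 0)"
  have "ah_norm (2 * n + 1) z \<ge> 0"
    by (intro ah_norm_nonneg z) simp
  then show "pi_norm n z / ah_norm (2 * n + 1) z \<le> zeta2"
    using pi_norm_le_ah_norm[OF assms z] zeta2_pos
    \<comment> \<open>If the denominator is 0, the quotient is 0 by the convention for
      division.\<close>
    by (cases "ah_norm (2 * n + 1) z = 0") (auto simp: pos_divide_le_eq)
qed

section \<open>Matrix units and the lower bound\<close>

text \<open>The matrix with a single 1, in row \<open>p\<close> and column \<open>j\<close>. The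
  guard makes it the canonical representative, vanishing outside s'.\<close>

definition matrix_unit :: "nat \<Rightarrow> nat \<Rightarrow> op" where
  "matrix_unit p j = (\<lambda>\<eta> i. if \<eta> \<in> s_dual \<and> i = p then \<eta> j else 0)"

lemma snorm_single: "snorm n (\<lambda>i. if i = p then c else 0) = cmod c * real (Suc p) ^ n"
proof -
  have "(\<lambda>i. (cmod (if i = p then c else 0) * real (Suc i) ^ n)\<^sup>2)
      = (\<lambda>i. if i = p then (cmod c * real (Suc i) ^ n)\<^sup>2 else 0)"
    by auto
  then show ?thesis
    unfolding snorm_alt
    using sums_unique[OF sums_single[of p "\<lambda>i. (cmod c * real (Suc i) ^ n)\<^sup>2"], symmetric]
    by (simp del: of_nat_Suc)
qed

lemma s_space_single: "(\<lambda>i. if i = p then c else 0) \<in> s_space"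
proof (rule s_space_of_entries)
  fix n :: nat
  show "\<exists>K. \<forall>i. cmod (if i = p then c else 0) * real (Suc i) ^ n \<le> K"
    by (rule exI[of _ "cmod c * real (Suc p) ^ n"]) simp
qed

lemma matrix_unit_NCS: "matrix_unit p j \<in> NCS"
proof -
  have "continuous_op (matrix_unit p j)"
    unfolding continuous_op_def
  proof (intro allI impI exI conjI ballI)
    fix n :: nat assume "n \<ge> 1"
    \<comment> \<open>This singleton suffices: pairing with \<open>unit_seq j\<close> has modulus
      \<open>cmod (\<eta> j)\<close>, and the output is a multiple of \<open>unit_seq p\<close>,
      whose norm of index \<open>n\<close> is the constant \<open>(p+1)^n\<close>.\<close>
    show "s_bounded {unit_seq j}"
      using s_space_single[of j 1] by (simp add: s_bounded_def)
    fix \<eta> assume "\<eta> \<in> s_dual"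
    then show "snorm n (matrix_unit p j \<eta>)
        \<le> real (Suc p) ^ n * Sup ((\<lambda>\<xi>. cmod (pairing \<xi> \<eta>)) ` {unit_seq j})"
      by (simp add: matrix_unit_def snorm_single pairing_unit_seq_left)
  qed
  moreover have "matrix_unit p j \<eta> \<in> s_space" if "\<eta> \<in> s_dual" for \<eta>
    using s_space_single[of p "\<eta> j"] that by (simp add: matrix_unit_def)
  ultimately show ?thesis
    unfolding NCS_def by (auto simp: matrix_unit_def s_dual_add s_dual_cmult fun_eq_iff)
qed

lemma op_adj_matrix_unit: "op_adj (matrix_unit p j) = matrix_unit j p"
proof
  fix \<xi>
  show "op_adj (matrix_unit p j) \<xi> = matrix_unit j p \<xi>"
  proof (cases "\<xi> \<in> s_dual")
    case True
    have "pairing \<xi> (matrix_unit p j (unit_seq b)) = (if b = j then \<xi> p else 0)" for b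
    proof (cases "b = j")
      case True
      then have "matrix_unit p j (unit_seq b) = unit_seq p"
        by (simp add: matrix_unit_def)
      then show ?thesis
        using True by (simp add: pairing_unit_seq)
    next
      case False
      then have "matrix_unit p j (unit_seq b) = (\<lambda>_. 0)"
        by (simp add: matrix_unit_def fun_eq_iff)
      then show ?thesis
        using False by (simp add: pairing_def)
    qed
    then show ?thesis
      by (simp add: op_adj_eq[OF NCS_smoothing[OF matrix_unit_NCS] True])
        (simp add: matrix_unit_def True)
  next
    case False
    then show ?thesis
      by (simp add: op_adj_def matrix_unit_def)
  qed
qed

text \<open>The two products of a matrix unit with its adjoint are the diagonal units at
  \<open>j\<close> and at \<open>p\<close>.\<close>

lemma op_absq_matrix_unit:
  assumes "\<eta> \<in> s_dual"
  shows "op_absq (matrix_unit p j) \<eta> i = ((if i = j then \<eta> j else 0) + (if i = p then \<eta> p else 0)) / 2"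
proof -
  have "op_mult (matrix_unit q l) (matrix_unit l q) \<eta> i = (if i = q then \<eta> q else 0)" for q l
    using assms s_space_subset_s_dual[OF s_space_single[of l "\<eta> q"]]
    by (simp add: op_mult_def matrix_unit_def)
  then show ?thesis
    unfolding op_absq_def op_adj_matrix_unit by simp
qed

text \<open>Summing squares of the entrywise hypothesis gives the norm bound. For a diagonal matrix
  the hypothesis holds once each entry times \<open>(i+1)^(2n)\<close> has modulus at most
  \<open>D\<close>, so this is the upper counterpart of \<open>diagonal_le_opnorm\<close>.\<close>

lemma opnorm_le_of_diagonal_bound:
  assumes n: "n \<ge> 1" and D: "D \<ge> 0"
    and le: "\<And>\<eta> i. dual_finite n \<eta> \<Longrightarrow>
      cmod (x \<eta> i) * real (Suc i) ^ n \<le> D * (cmod (\<eta> i) / real (Suc i) ^ n)"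
  shows "opnorm n x \<le> D"
proof (rule opnorm_le[OF n])
  fix \<eta> assume \<eta>: "dual_finite n \<eta>" "dnorm n \<eta> \<le> 1"
  have s: "summable (\<lambda>i. D\<^sup>2 * (cmod (\<eta> i) / real (Suc i) ^ n)\<^sup>2)"
    using \<eta>(1) unfolding dual_finite_alt by (rule summable_mult)
  have le2: "(cmod (x \<eta> i) * real (Suc i) ^ n)\<^sup>2 \<le> D\<^sup>2 * (cmod (\<eta> i) / real (Suc i) ^ n)\<^sup>2" for i
    unfolding power_mult_distrib[of D, symmetric] using le[OF \<eta>(1), of i] by (intro power_mono) auto
  have "(\<Sum>i. (cmod (x \<eta> i) * real (Suc i) ^ n)\<^sup>2) \<le> (\<Sum>i. D\<^sup>2 * (cmod (\<eta> i) / real (Suc i) ^ n)\<^sup>2)"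
    by (intro suminf_le le2 s summable_comparison_test'[OF s]) (use le2 in auto)
  also have "\<dots> = D\<^sup>2 * (dnorm n \<eta>)\<^sup>2"
    using \<eta>(1) unfolding dnorm_power2[OF \<eta>(1)] dual_finite_alt by (rule suminf_mult)
  also have "\<dots> \<le> D\<^sup>2"
    using \<eta> dnorm_nonneg[OF \<eta>(1)] by (simp add: mult_left_le power_le_one)
  finally have "snorm n (x \<eta>) \<le> sqrt (D\<^sup>2)"
    unfolding snorm_alt by (rule real_sqrt_le_mono)
  then show "snorm n (x \<eta>) \<le> D"
    using D by simp
qed

text \<open>A weighted operator dominates the Euclidean norm of any finite piece of one of its rows.
  The row contributes its weight, and the columns contribute at least \<open>M^n\<close>.\<close>

lemma opnorm_row_bound:
  assumes x: "smoothing x" and n: "n \<ge> 1" and J: "finite J" and M: "M > 0" "\<And>j. j \<in> J \<Longrightarrow> M \<le> real (Suc j)"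
  shows "(real (Suc p) * M) ^ n * sqrt (\<Sum>j\<in>J. (cmod (x (unit_seq j) p))\<^sup>2) \<le> opnorm n x"
proof (cases "(\<Sum>j\<in>J. (cmod (x (unit_seq j) p))\<^sup>2) = 0")
  case True
  then show ?thesis
    using opnorm_nonneg[OF x n] by simp
next
  case False
  define r where "r = (\<Sum>j\<in>J. (cmod (x (unit_seq j) p))\<^sup>2)"
  have r: "r > 0"
    using False unfolding r_def by (simp add: order_less_le sum_nonneg)
  \<comment> \<open>The conjugated piece of the row is the test vector: it turns the output entry at
    \<open>p\<close> into the sum of squares \<open>r\<close>. One factor \<open>sqrt r\<close> is
    cancelled at the end, hence the case distinction.\<close>
  define \<eta> where "\<eta> = (\<lambda>j. if j \<in> J then cnj (x (unit_seq j) p) else 0)"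
  have "(\<lambda>j. (cmod (\<eta> j) / real (Suc j) ^ n)\<^sup>2)
      = (\<lambda>j. if j \<in> J then (cmod (x (unit_seq j) p) / real (Suc j) ^ n)\<^sup>2 else 0)"
    by (auto simp: \<eta>_def)
  then have sums: "(\<lambda>j. (cmod (\<eta> j) / real (Suc j) ^ n)\<^sup>2)
      sums (\<Sum>j\<in>J. (cmod (x (unit_seq j) p) / real (Suc j) ^ n)\<^sup>2)"
    using sums_If_finite_set[OF J] by (simp del: of_nat_Suc)
  have \<eta>: "dual_finite n \<eta>"
    unfolding dual_finite_alt by (rule sums_summable[OF sums])
  have "(\<Sum>j\<in>J. (cmod (x (unit_seq j) p) / real (Suc j) ^ n)\<^sup>2)
      \<le> (\<Sum>j\<in>J. (cmod (x (unit_seq j) p) / M ^ n)\<^sup>2)"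
    using M by (intro sum_mono power_mono divide_left_mono) auto
  also have "\<dots> = r / (M ^ n)\<^sup>2"
    by (simp add: r_def power_divide sum_divide_distrib)
  finally have "dnorm n \<eta> \<le> sqrt (r / (M ^ n)\<^sup>2)"
    unfolding dnorm_alt sums_unique[OF sums, symmetric] by (rule real_sqrt_le_mono)
  then have dn: "dnorm n \<eta> \<le> sqrt r / M ^ n"
    using M(1) by (simp add: real_sqrt_divide)
  have "(\<lambda>j. \<eta> j * x (unit_seq j) p)
      = (\<lambda>j. if j \<in> J then cnj (x (unit_seq j) p) * x (unit_seq j) p else 0)"
    by (auto simp: \<eta>_def)
  then have "(\<lambda>j. \<eta> j * x (unit_seq j) p) sums (\<Sum>j\<in>J. cnj (x (unit_seq j) p) * x (unit_seq j) p)"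
    using sums_If_finite_set[OF J] by simp
  then have "x \<eta> p = (\<Sum>j\<in>J. cnj (x (unit_seq j) p) * x (unit_seq j) p)"
    using sums_unique2[OF smoothing_expansion[OF x s_dualI[OF n \<eta>]]] by blast
  also have "\<dots> = of_real r"
    unfolding r_def of_real_sum complex_norm_square by (simp only: mult.commute)
  finally have "cmod (x \<eta> p) = r"
    using r by simp
  then have "r * real (Suc p) ^ n \<le> opnorm n x * dnorm n \<eta>"
    using norm_entry_le_snorm[OF n smoothing_s_space[OF x s_dualI[OF n \<eta>]], of p]
      opnorm_bound[OF x n \<eta>] by simp
  also have "\<dots> \<le> opnorm n x * (sqrt r / M ^ n)"
    by (intro mult_left_mono dn opnorm_nonneg x n)
  finally have "sqrt r * (sqrt r * real (Suc p) ^ n) \<le> sqrt r * (opnorm n x / M ^ n)"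
    using r by (simp add: mult.assoc[symmetric] mult.commute)
  then have "sqrt r * real (Suc p) ^ n \<le> opnorm n x / M ^ n"
    using r by (simp only: mult_le_cancel_left_pos real_sqrt_gt_0_iff)
  then show ?thesis
    using M(1) by (simp add: pos_le_divide_eq power_mult_distrib mult_ac r_def del: of_nat_Suc)
qed

section \<open>Extremal row tensors and estimates of their two norms\<close>

definition row_unit :: "nat \<Rightarrow> nat \<Rightarrow> nat \<Rightarrow> op" where
  "row_unit p Q l = matrix_unit p (Q + l)"

text \<open>The identity tensor of a \<open>Q\<close>-dimensional Hilbert space, placed in row
  \<open>p\<close> and columns \<open>Q\<close> to \<open>2Q - 1\<close>, so that all column weights
  lie between \<open>Q\<close> and \<open>2Q\<close>.\<close>

definition row_tensor :: "nat \<Rightarrow> nat \<Rightarrow> tens" where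
  "row_tensor p Q = tensor_of Q (row_unit p Q) (row_unit p Q)"

lemma row_unit_NCS: "row_unit p Q l \<in> NCS"
  unfolding row_unit_def by (rule matrix_unit_NCS)

lemma row_tensor_entry:
  assumes "j \<in> {Q..<2 * Q}"
  shows "row_tensor p Q (unit_seq j, p) (unit_seq j, p) = 1"
proof -
  have "row_tensor p Q (unit_seq j, p) (unit_seq j, p) = (\<Sum>l<Q. unit_seq j (Q + l) * unit_seq j (Q + l))"
    by (simp add: row_tensor_def tensor_of_def row_unit_def matrix_unit_def)
  also have "\<dots> = (\<Sum>l<Q. if l = j - Q then 1 else 0)"
    using assms by (intro sum.cong) auto
  also have "\<dots> = 1"
    using assms by auto
  finally show ?thesis .
qed

lemma row_tensor_in: "row_tensor p Q \<in> NCS_tensor"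
  unfolding NCS_tensor_def row_tensor_def using row_unit_NCS by blast

lemma row_tensor_nonzero:
  assumes "Q \<ge> 1"
  shows "row_tensor p Q \<noteq> (\<lambda>_ _. 0)"
  using row_tensor_entry[of Q Q p] assms by auto

text \<open>Trace duality: summing the entries at equal columns of \<open>J\<close> gives a
  functional with value \<open>Q\<close> on the tensor. By Cauchy--Schwarz its value on an
  elementary tensor is at most the product of two row norms, which \<open>opnorm_row_bound\<close>
  with \<open>M = Q\<close> converts to operator norms.\<close>

lemma row_tensor_pi_norm_ge:
  assumes n: "n \<ge> 1" and Q: "Q \<ge> 1"
  shows "real Q * (real (Suc p) * real Q) ^ (2 * n) \<le> pi_norm n (row_tensor p Q)"
proof (rule le_pi_norm[OF row_tensor_in row_tensor_nonzero[OF Q]])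
  fix m :: nat and X Y
  assume rep: "\<forall>l<m. X l \<in> NCS \<and> Y l \<in> NCS" "tensor_of m X Y = row_tensor p Q"
  define J where "J = {Q..<2 * Q}"
  define W where "W = (real (Suc p) * real Q) ^ n"
  define r where "r = (\<lambda>x::op. sqrt (\<Sum>j\<in>J. (cmod (x (unit_seq j) p))\<^sup>2))"
  have r_le: "W * r x \<le> opnorm n x" if "x \<in> NCS" for x
    unfolding W_def r_def using Q
    by (intro opnorm_row_bound NCS_smoothing that n) (auto simp: J_def)
  have "(\<Sum>j\<in>J. \<Sum>l<m. X l (unit_seq j) p * Y l (unit_seq j) p) = of_nat Q"
  proof -
    have "(\<Sum>l<m. X l (unit_seq j) p * Y l (unit_seq j) p) = 1" if "j \<in> J" for j
      using row_tensor_entry[of j Q p] that unfolding rep(2)[symmetric] tensor_of_def J_def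
      by simp
    then show ?thesis
      by (simp add: J_def)
  qed
  then have "real Q = cmod (\<Sum>j\<in>J. \<Sum>l<m. X l (unit_seq j) p * Y l (unit_seq j) p)"
    by simp
  also have "\<dots> = cmod (\<Sum>l<m. \<Sum>j\<in>J. X l (unit_seq j) p * Y l (unit_seq j) p)"
    by (subst sum.swap) (rule refl)
  also have "\<dots> \<le> (\<Sum>l<m. \<Sum>j\<in>J. cmod (X l (unit_seq j) p) * cmod (Y l (unit_seq j) p))"
    by (intro order_trans[OF norm_sum] sum_mono) (simp add: norm_mult)
  also have "\<dots> \<le> (\<Sum>l<m. r (X l) * r (Y l))"
    unfolding r_def by (intro sum_mono sum_mult_le_sqrt)
  finally have "real Q * (W * W) \<le> (\<Sum>l<m. r (X l) * r (Y l)) * (W * W)"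
    by (intro mult_right_mono) (auto simp: W_def)
  also have "\<dots> = (\<Sum>l<m. (W * r (X l)) * (W * r (Y l)))"
    unfolding sum_distrib_right by (intro sum.cong refl) (simp add: mult_ac)
  also have "\<dots> \<le> (\<Sum>l<m. opnorm n (X l) * opnorm n (Y l))"
    using rep(1) by (intro sum_mono mult_mono r_le opnorm_nonneg NCS_smoothing n)
      (auto simp: W_def r_def intro!: mult_nonneg_nonneg sum_nonneg)
  finally show "real Q * (real (Suc p) * real Q) ^ (2 * n) \<le> (\<Sum>l<m. opnorm n (X l) * opnorm n (Y l))"
    by (simp only: W_def power_add[symmetric] mult_2)
qed

text \<open>An entry in row \<open>p\<close> contributes half its squared modulus to the diagonal of
  the absolute square at \<open>p\<close>, which explains the factor 2. The weight at
  \<open>p\<close> is at least 1.\<close>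

lemma sum_entry_power2_le:
  assumes X: "\<And>l. l < m \<Longrightarrow> smoothing (X l)" and k: "k \<ge> 1"
  shows "(\<Sum>l<m. (cmod (X l (unit_seq j) p))\<^sup>2) \<le> 2 * opnorm k (sum_absq m X)"
proof -
  have "(cmod (X l (unit_seq j) p))\<^sup>2 \<le> 2 * Re (op_absq (X l) (unit_seq p) p)" if "l < m" for l
  proof -
    note diag = op_absq_diagonal[OF X[OF that], of p]
    have "(\<Sum>i\<in>{j}. (cmod (X l (unit_seq i) p))\<^sup>2) \<le> (\<Sum>i. (cmod (X l (unit_seq i) p))\<^sup>2)"
      by (intro sum_le_suminf diag) auto
    moreover have "0 \<le> (\<Sum>i. (cmod (X l (unit_seq p) i))\<^sup>2)"
      by (intro suminf_nonneg diag) auto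
    ultimately show ?thesis
      unfolding diag(3) Re_complex_of_real by simp
  qed
  then have "(\<Sum>l<m. (cmod (X l (unit_seq j) p))\<^sup>2) \<le> (\<Sum>l<m. 2 * Re (op_absq (X l) (unit_seq p) p))"
    by (intro sum_mono) auto
  also have "\<dots> = 2 * Re (sum_absq m X (unit_seq p) p)"
    by (simp add: sum_absq_def sum_distrib_left)
  also have "\<dots> \<le> 2 * (cmod (sum_absq m X (unit_seq p) p) * 1)"
    using complex_Re_le_cmod by simp
  also have "\<dots> \<le> 2 * (cmod (sum_absq m X (unit_seq p) p) * real (Suc p) ^ (2 * k))"
    by (intro mult_left_mono one_le_power) auto
  also have "\<dots> \<le> 2 * opnorm k (sum_absq m X)"
    by (intro mult_left_mono diagonal_le_opnorm smoothing_sum_absq X k) auto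
  finally show ?thesis .
qed

text \<open>A crude positive bound, from the single entry at column \<open>Q\<close>, guarantees
  that the ratio is a true quotient and not a division by 0.\<close>

lemma row_tensor_ah_norm_ge:
  assumes k: "k \<ge> 1" and Q: "Q \<ge> 1"
  shows "1 / 2 \<le> ah_norm k (row_tensor p Q)"
proof (rule le_ah_norm[OF row_tensor_in row_tensor_nonzero[OF Q]])
  fix m :: nat and X Y
  assume rep: "\<forall>l<m. X l \<in> NCS \<and> Y l \<in> NCS" "tensor_of m X Y = row_tensor p Q"
  have "(\<Sum>l<m. X l (unit_seq Q) p * Y l (unit_seq Q) p) = 1"
    using row_tensor_entry[of Q Q p] Q unfolding rep(2)[symmetric] tensor_of_def by simp
  then have "1 = cmod (\<Sum>l<m. X l (unit_seq Q) p * Y l (unit_seq Q) p)"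
    by simp
  also have "\<dots> \<le> (\<Sum>l<m. cmod (X l (unit_seq Q) p) * cmod (Y l (unit_seq Q) p))"
    by (rule order_trans[OF norm_sum]) (simp add: norm_mult)
  also have "\<dots> \<le> sqrt (\<Sum>l<m. (cmod (X l (unit_seq Q) p))\<^sup>2) * sqrt (\<Sum>l<m. (cmod (Y l (unit_seq Q) p))\<^sup>2)"
    by (rule sum_mult_le_sqrt)
  also have "\<dots> \<le> sqrt (2 * opnorm k (sum_absq m X)) * sqrt (2 * opnorm k (sum_absq m Y))"
    using rep(1)
    by (intro mult_mono real_sqrt_le_mono sum_entry_power2_le NCS_smoothing k real_sqrt_ge_zero
        sum_nonneg mult_nonneg_nonneg opnorm_nonneg smoothing_sum_absq) auto
  also have "\<dots> = 2 * (sqrt (opnorm k (sum_absq m X)) * sqrt (opnorm k (sum_absq m Y)))"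
    by (simp add: real_sqrt_mult)
  finally show "1 / 2 \<le> sqrt (opnorm k (sum_absq m X)) * sqrt (opnorm k (sum_absq m Y))"
    by simp
qed

text \<open>The absolute squares are averages of two diagonal units. The column units are distinct,
  whereas the row unit at \<open>p\<close> is counted \<open>Q\<close> times; the two terms add, so
  \<open>p\<close> may lie among the columns.\<close>

lemma sum_absq_row_unit:
  assumes "\<eta> \<in> s_dual"
  shows "sum_absq Q (row_unit p Q) \<eta> i =
    ((if Q \<le> i \<and> i < 2 * Q then 1 else 0) + (if i = p then of_nat Q else 0)) / 2 * \<eta> i"
proof -
  have "(\<Sum>l<Q. if i = Q + l then \<eta> (Q + l) else 0) = (if Q \<le> i \<and> i < 2 * Q then \<eta> i else 0)"
  proof (cases "Q \<le> i")
    case True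
    then have "(\<Sum>l<Q. if i = Q + l then \<eta> (Q + l) else 0) = (\<Sum>l<Q. if l = i - Q then \<eta> i else 0)"
      by (intro sum.cong) auto
    then show ?thesis
      using True by auto
  qed (auto intro!: sum.neutral)
  then have "(\<Sum>l<Q. op_absq (row_unit p Q l) \<eta> i)
      = ((if Q \<le> i \<and> i < 2 * Q then \<eta> i else 0) + of_nat Q * (if i = p then \<eta> p else 0)) / 2"
    by (simp add: row_unit_def op_absq_matrix_unit[OF assms] sum.distrib flip: sum_divide_distrib)
  then show ?thesis
    by (auto simp: sum_absq_def algebra_simps)
qed

text \<open>The defining representation is used on both sides. Its absolute square is diagonal:
  columns have weight at most \<open>(2Q)^(4n)\<close> because \<open>k \<le> 2 * n\<close>, and
  \<open>balance\<close> keeps the \<open>Q\<close>-fold entry at \<open>p\<close> below the same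
  bound.\<close>

lemma row_tensor_ah_norm_le:
  assumes k: "k \<ge> 1" "k \<le> 2 * n" and Q: "Q \<ge> 1"
    and balance: "real Q * real (Suc p) ^ (4 * n) \<le> real Q ^ (4 * n)"
  shows "ah_norm k (row_tensor p Q) \<le> (2 * real Q) ^ (4 * n)"
proof -
  define D where "D = (2 * real Q) ^ (4 * n)"
  have D: "D \<ge> 0" by (simp add: D_def)
  have pow: "real (Suc i) ^ (2 * k) \<le> real (Suc i) ^ (4 * n)" for i
    using k by (intro power_increasing) auto
  have weight: "((if Q \<le> i \<and> i < 2 * Q then 1 else 0) + (if i = p then real Q else 0)) / 2
      * real (Suc i) ^ (2 * k) \<le> D" for i
  proof -
    have "(if Q \<le> i \<and> i < 2 * Q then 1 else 0) * real (Suc i) ^ (2 * k) \<le> D"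
    proof (cases "Q \<le> i \<and> i < 2 * Q")
      case True
      have "real (Suc i) ^ (4 * n) \<le> D"
        unfolding D_def using True by (intro power_mono) auto
      from order_trans[OF pow this] True show ?thesis by simp
    qed (use D in auto)
    moreover have "(if i = p then real Q else 0) * real (Suc i) ^ (2 * k) \<le> D"
    proof (cases "i = p")
      case True
      have "real Q * real (Suc p) ^ (2 * k) \<le> real Q * real (Suc p) ^ (4 * n)"
        by (intro mult_left_mono pow) auto
      also have "\<dots> \<le> D"
        unfolding D_def by (rule order_trans[OF balance power_mono]) auto
      finally show ?thesis using True by simp
    qed (use D in auto)
    moreover have "(a + b) / 2 * c \<le> D" if "a * c \<le> D" "b * c \<le> D" for a b c :: real
      using that by (simp add: field_simps)
    ultimately show ?thesis by blast
  qed
  have "opnorm k (sum_absq Q (row_unit p Q)) \<le> D"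
  proof (rule opnorm_le_of_diagonal_bound[OF k(1) D])
    fix \<eta> i assume "dual_finite k \<eta>"
    then have \<eta>: "\<eta> \<in> s_dual" by (rule s_dualI[OF k(1)])
    define c where "c = ((if Q \<le> i \<and> i < 2 * Q then 1 else 0) + (if i = p then real Q else 0)) / 2"
    have "c \<ge> 0" by (simp add: c_def)
    have "sum_absq Q (row_unit p Q) \<eta> i = of_real c * \<eta> i"
      unfolding sum_absq_row_unit[OF \<eta>] c_def by simp
    then have "cmod (sum_absq Q (row_unit p Q) \<eta> i) * real (Suc i) ^ k
        = c * real (Suc i) ^ (2 * k) * (cmod (\<eta> i) / real (Suc i) ^ k)"
      using \<open>c \<ge> 0\<close> by (simp add: norm_mult mult_2 power_add del: of_nat_Suc)
    also have "\<dots> \<le> D * (cmod (\<eta> i) / real (Suc i) ^ k)"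
      unfolding c_def by (intro mult_right_mono weight) auto
    finally show "cmod (sum_absq Q (row_unit p Q) \<eta> i) * real (Suc i) ^ k
        \<le> D * (cmod (\<eta> i) / real (Suc i) ^ k)" .
  qed
  moreover have "opnorm k (sum_absq Q (row_unit p Q)) \<ge> 0"
    by (intro opnorm_nonneg smoothing_sum_absq NCS_smoothing row_unit_NCS k(1))
  moreover have "ah_norm k (row_tensor p Q)
      \<le> sqrt (opnorm k (sum_absq Q (row_unit p Q))) * sqrt (opnorm k (sum_absq Q (row_unit p Q)))"
    unfolding row_tensor_def by (intro ah_norm_le k Q) (simp add: row_unit_NCS)
  ultimately show ?thesis
    unfolding D_def by simp
qed

text \<open>With \<open>Q = t\<^bsup>4n\<^esup>\<close> and \<open>p + 1 = t\<^bsup>4n-1\<^esup>\<close> the two summands of the absolute square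
  of the extremal row have comparable norms, while the ratio of the tensor norms is at least a multiple of
  \<open>t\<^bsup>2n\<^esup>\<close>.\<close>

lemma not_ratio_bounded:
  assumes n: "n \<ge> 1" and k: "k \<ge> 1" "k \<le> 2 * n"
  shows "\<not> ratio_bounded n k"
proof
  assume "ratio_bounded n k"
  then obtain C where C: "\<And>z. z \<in> NCS_tensor \<Longrightarrow> z \<noteq> (\<lambda>_ _. 0) \<Longrightarrow> pi_norm n z / ah_norm k z \<le> C"
    unfolding ratio_bounded_def bdd_above_def by blast
  have bound: "real t ^ (2 * n) \<le> \<bar>C\<bar> * 2 ^ (4 * n)" if t: "t \<ge> 1" for t :: nat
  proof -
    define Q where "Q = t ^ (4 * n)"
    \<comment> \<open>The subtraction compensates the index shift: the weight of row
      \<open>p\<close> is \<open>Suc p\<close>.\<close>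
    define p where "p = t ^ (4 * n - 1) - 1"
    have Q: "Q \<ge> 1" using t by (simp add: Q_def)
    have p: "Suc p = t ^ (4 * n - 1)" using t by (simp add: p_def)
    let ?z = "row_tensor p Q"
    \<comment> \<open>The first identity makes the balance condition an equality; the second
      exhibits the surplus \<open>t^(2n)\<close> of the projective bound over
      \<open>Q^(4n)\<close>.\<close>
    have exponents: "4 * n + (4 * n - 1) * (4 * n) = 4 * n * (4 * n)"
      "4 * n + (4 * n - 1 + 4 * n) * (2 * n) = 2 * n + 4 * n * (4 * n)"
      using n by (cases n; simp add: algebra_simps)+
    have "real Q * real (Suc p) ^ (4 * n) = real Q ^ (4 * n)"
      by (simp only: p Q_def of_nat_power power_mult[symmetric] power_add[symmetric] exponents)
    then have ah_le: "ah_norm k ?z \<le> (2 * real Q) ^ (4 * n)"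
      by (intro row_tensor_ah_norm_le k Q) simp
    have ah_ge: "1 / 2 \<le> ah_norm k ?z"
      by (rule row_tensor_ah_norm_ge[OF k(1) Q])
    have "real t ^ (2 * n) * real Q ^ (4 * n) = real Q * (real (Suc p) * real Q) ^ (2 * n)"
      by (simp only: p Q_def of_nat_power power_mult[symmetric] power_add[symmetric] exponents)
    also have "\<dots> \<le> pi_norm n ?z"
      by (rule row_tensor_pi_norm_ge[OF n Q])
    also have "\<dots> \<le> C * ah_norm k ?z"
      using C[OF row_tensor_in row_tensor_nonzero[OF Q], of p] ah_ge by (simp add: pos_divide_le_eq)
    also have "\<dots> \<le> \<bar>C\<bar> * ah_norm k ?z"
      using ah_ge by (intro mult_right_mono) auto
    also have "\<dots> \<le> \<bar>C\<bar> * (2 * real Q) ^ (4 * n)"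
      by (intro mult_left_mono ah_le) simp
    finally have "real t ^ (2 * n) * real Q ^ (4 * n) \<le> (\<bar>C\<bar> * 2 ^ (4 * n)) * real Q ^ (4 * n)"
      by (simp add: power_mult_distrib mult_ac)
    then show ?thesis
      using Q by (simp add: mult_le_cancel_right_pos)
  qed
  \<comment> \<open>Since \<open>t \<le> t^(2n)\<close> for \<open>t \<ge> 1\<close>, a
    \<open>t\<close> beyond the constant already contradicts \<open>bound\<close>.\<close>
  obtain t :: nat where t: "real t > \<bar>C\<bar> * 2 ^ (4 * n)"
    using reals_Archimedean2 by blast
  then have "t \<ge> 1"
    by (cases t) (auto simp: mult_less_0_iff)
  have "real t ^ 1 \<le> real t ^ (2 * n)"
    using n \<open>t \<ge> 1\<close> by (intro power_increasing) auto
  then show False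
    using bound[OF \<open>t \<ge> 1\<close>] t unfolding power_one_right by linarith
qed

theorem theorem3p3:
  fixes n :: nat
  assumes "n \<ge> 1"
  shows "ratio_bounded n (2*n+1) \<and> (\<forall>k::nat. 1 \<le> k \<and> k < 2*n+1 \<longrightarrow> \<not> ratio_bounded n k)"
  using ratio_bounded_upper[OF assms] not_ratio_bounded[OF assms] by auto

end
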